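(* For $\alpha\in(0,1]$ let $\xi=(\xi_k)_{k\ge 0}$ be a collection of independent Poisson point processes on $[0,1]$, each with intensity $\alpha$, and let $D\in\{1,2,\dots\}\cup\{\infty\}$ be the number of vertices of the bump tree $\gamma(\xi)$. Write $\mathbf{E}_\alpha$ for the corresponding expectation. If $\alpha\ge(\sqrt5-1)/2$, then $\mathbf{E}_\alpha[D^2]$ diverges, i.e. $\mathbf{E}_\alpha[D^2]=+\infty$. If $\alpha<(3-\sqrt5)/2$, then $\mathbf{E}_\alpha[D^2]$ is finite.
   Context: A point process on $[0,1]$ is an integer-valued measure on the Borel sets of $[0,1]$, viewed as a collection of points (its atoms). A Poisson point process on $[0,1]$ with intensity $\alpha$ is a random such measure for which the number of atoms in a Borel set $E$ of Lebesgue measure $\lambda$ is Poisson with mean $\alpha\lambda$, and the numbers of atoms in disjoint Borel sets are independent. A point process configuration is a sequence $\xi=(\xi_k)_{k\ge0}$ of point processes on $[0,1]$. For an atom $x\in\xi_0$, the bump map is $f(\xi,x)=(\xi'_k)_{k\ge0}$, where $\xi'_k=\xi_{k+1}|_{[0,x)}+\xi_k|_{(x,1]}$ (the atoms of $\xi_{k+1}$ in $[0,x)$ together with the atoms of $\xi_k$ in $(x,1]$). The bump tree $\gamma(\xi)$ is the rooted tree defined recursively, each vertex $v$ carrying a configuration $\xi^v$: the root $v_0$ carries $\xi^{v_0}=\xi$; a vertex $v$ has exactly one child $v(x)$ for each atom $x\in\xi^v_0$, and this child carries $\xi^{v(x)}=f(\xi^v,x)$. (Almost surely all atoms of $\xi$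 are at distinct locations.) *)

theory Defs
  imports "HOL-Probability.Probability"
begin

abbreviation unit_borel :: "real measure" where
  "unit_borel \<equiv> restrict_space borel {0..1}"

text \<open>Here \<open>\<nat>\<close> is a subset of \<^typ>\<open>ennreal\<close>, so it does not contain \<open>\<infinity>\<close>: integer-valued
  measures are finite.\<close>

definition integer_valued_measure :: "real measure \<Rightarrow> bool" where
  "integer_valued_measure \<mu> \<longleftrightarrow> sets \<mu> = sets unit_borel \<and> (\<forall>E\<in>sets \<mu>. emeasure \<mu> E \<in> \<nat>)"

text \<open>The integer-valued measures with the smallest \<open>\<sigma>\<close>-algebra making all counts \<open>\<mu> \<mapsto> \<mu> E\<close> measurable
  (compare \<^const>\<open>subprob_algebra\<close>).\<close>

definition point_process_algebra :: "real measure measure" where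
  "point_process_algebra =
    (SUP E \<in> sets unit_borel. vimage_algebra {\<mu>. integer_valued_measure \<mu>} (\<lambda>\<mu>. emeasure \<mu> E) borel)"

text \<open>The Poisson law is written out because \<^const>\<open>poisson_pmf\<close> is specified only for a positive
  rate, whereas \<open>E\<close> may be a null set (then \<open>0 ^ 0 = 1\<close> gives the point mass at \<open>0\<close>).
  Indexing by all natural numbers covers finite families, as \<open>E i\<close> may be empty.\<close>

definition poisson_point_process :: "'w measure \<Rightarrow> real \<Rightarrow> ('w \<Rightarrow> real measure) \<Rightarrow> bool" where
  "poisson_point_process M \<alpha> N \<longleftrightarrow>
     N \<in> measurable M point_process_algebra \<and>
     (\<forall>E\<in>sets unit_borel. \<forall>n::nat.
        measure M {\<omega>\<in>space M. emeasure (N \<omega>) E = of_nat n}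
          = (\<alpha> * measure lborel E) ^ n / fact n * exp (- (\<alpha> * measure lborel E))) \<and>
     (\<forall>E :: nat \<Rightarrow> real set. range E \<subseteq> sets unit_borel \<longrightarrow> disjoint_family E \<longrightarrow>
        prob_space.indep_vars M (\<lambda>_. borel) (\<lambda>i \<omega>. emeasure (N \<omega>) (E i)) UNIV)"

type_synonym configuration = "nat \<Rightarrow> real measure"

definition atoms :: "real measure \<Rightarrow> real set" where
  "atoms \<mu> = {x. emeasure \<mu> {x} > 0}"

definition bump :: "configuration \<Rightarrow> real \<Rightarrow> configuration" where
  "bump \<xi> x = (\<lambda>k. measure_of {0..1} (sets unit_borel)
     (\<lambda>E. emeasure (\<xi> (Suc k)) (E \<inter> {0..<x}) + emeasure (\<xi> k) (E \<inter> {x<..1})))"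

text \<open>A vertex of the bump tree is represented by the list of atoms chosen on the path from the
  root to it: the root is \<^term>\<open>[]\<close>, and the child \<open>v(x)\<close> of \<open>v\<close> is \<^term>\<open>v @ [x]\<close>.
  The configuration \<open>\<xi>\<^sup>v\<close> carried by \<open>v\<close> is \<open>vertex_config \<xi> v\<close>.
  An atom of multiplicity greater than one (for Poisson processes a null event) yields one child.\<close>

definition vertex_config :: "configuration \<Rightarrow> real list \<Rightarrow> configuration" where
  "vertex_config \<xi> v = foldl bump \<xi> v"

inductive_set bump_tree :: "configuration \<Rightarrow> real list set" for \<xi> :: configuration where
  root: "[] \<in> bump_tree \<xi>"
| child: "v \<in> bump_tree \<xi> \<Longrightarrow> x \<in> atoms (vertex_config \<xi> v 0) \<Longrightarrow> v @ [x] \<in> bump_tree \<xi>"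

definition bump_tree_size :: "configuration \<Rightarrow> enat" where
  "bump_tree_size \<xi> = (if finite (bump_tree \<xi>) then enat (card (bump_tree \<xi>)) else \<infinity>)"

lemma space_point_process_algebra: "space point_process_algebra = {\<mu>. integer_valued_measure \<mu>}"
  by (auto simp add: point_process_algebra_def space_Sup_eq_UN)

lemma measurable_count:
  assumes "E \<in> sets unit_borel"
  shows "(\<lambda>\<mu>. emeasure \<mu> E) \<in> borel_measurable point_process_algebra"
  using assms by (auto intro!: measurable_Sup1 measurable_vimage_algebra1
      simp: point_process_algebra_def)

lemma sets_bump: "sets (bump \<xi> x k) = sets unit_borel"
proof -
  have "sets unit_borel \<subseteq> Pow {0..1}"
    using sets.space_closed[of unit_borel] by simp
  moreover have "sigma_sets {0..1} (sets unit_borel) = sets unit_borel"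
    using sets.sigma_sets_eq[of unit_borel] by simp
  ultimately show ?thesis
    by (simp add: bump_def)
qed

lemma emeasure_bump:
  assumes s: "\<And>k. sets (\<xi> k) = sets unit_borel" and E: "E \<in> sets unit_borel"
  shows "emeasure (bump \<xi> x k) E
    = emeasure (\<xi> (Suc k)) (E \<inter> {0..<x}) + emeasure (\<xi> k) (E \<inter> {x<..1})"
proof -
  have i: "A \<inter> {0..<x} \<in> sets unit_borel" "A \<inter> {x<..1} \<in> sets unit_borel"
    if "A \<in> sets unit_borel" for A
    using that by (auto simp: sets_restrict_space_iff)
  have *: "bump \<xi> x k = measure_of {0..1} (sets unit_borel)
     (\<lambda>E. emeasure (\<xi> (Suc k)) (E \<inter> {0..<x}) + emeasure (\<xi> k) (E \<inter> {x<..1}))"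
    by (simp add: bump_def)
  show ?thesis
  proof (rule emeasure_measure_of[OF *])
    show "sets unit_borel \<subseteq> Pow {0..1}"
      using sets.space_closed[of unit_borel] by simp
    show "E \<in> sets (bump \<xi> x k)"
      using E by (simp add: sets_bump)
    show "positive (sets (bump \<xi> x k)) (\<lambda>E. emeasure (\<xi> (Suc k)) (E \<inter> {0..<x}) + emeasure (\<xi> k) (E \<inter> {x<..1}))"
      by (simp add: positive_def)
    show "countably_additive (sets (bump \<xi> x k)) (\<lambda>E. emeasure (\<xi> (Suc k)) (E \<inter> {0..<x}) + emeasure (\<xi> k) (E \<inter> {x<..1}))"
    proof (rule countably_additiveI)
      fix A :: "nat \<Rightarrow> real set"
      assume A: "range A \<subseteq> sets (bump \<xi> x k)" "disjoint_family A"
      have "(\<Sum>i. emeasure (\<xi> j) (A i \<inter> S)) = emeasure (\<xi> j) (\<Union>i. A i \<inter> S)"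
        if "\<And>i. A i \<inter> S \<in> sets unit_borel" for j S
        using that A(2) s[of j] by (intro suminf_emeasure) (auto simp: disjoint_family_on_def)
      then show "(\<Sum>i. emeasure (\<xi> (Suc k)) (A i \<inter> {0..<x}) + emeasure (\<xi> k) (A i \<inter> {x<..1})) =
         emeasure (\<xi> (Suc k)) ((\<Union>i. A i) \<inter> {0..<x}) + emeasure (\<xi> k) ((\<Union>i. A i) \<inter> {x<..1})"
        using A(1) i by (simp add: suminf_add[symmetric] sets_bump image_subset_iff)
    qed
  qed
qed

lemma integer_valued_measure_bump:
  assumes "\<And>k. integer_valued_measure (\<xi> k)"
  shows "integer_valued_measure (bump \<xi> x k)"
proof -
  have s: "sets (\<xi> k) = sets unit_borel" for k
    using assms by (simp add: integer_valued_measure_def)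
  have "A \<inter> {0..<x} \<in> sets unit_borel" "A \<inter> {x<..1} \<in> sets unit_borel"
    if "A \<in> sets unit_borel" for A
    using that by (auto simp: sets_restrict_space_iff)
  then show ?thesis
    using assms by (auto simp: integer_valued_measure_def sets_bump emeasure_bump[OF s] intro!: Nats_add)
qed

end

theory Submission
  imports Defs "HOL-Real_Asymp.Real_Asymp"
begin

text \<open>
A vertex of the bump tree is a list of distinct positions in which each entry \<open>x\<close> is an atom
of layer \<open>c\<close>, where \<open>c\<close> is the number of larger entries before it. Read as an inversion table, this
identifies vertices with finite sets of points \<open>(x, c)\<close>, one per position, having at least \<open>c\<close>
points of the set to the right of each member \<open>(x, c)\<close>. Scanning from right to left, a set with
\<open>s\<close> points can be extended by an atom of any of the layers \<open>0, \<dots>, s\<close>. The expected number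
\<open>P(s, t)\<close> of pairs of such sets with \<open>s\<close> and \<open>t\<close> points hence has the derivative
\<open>\<alpha> (s P(s - 1, t) + t P(s, t - 1) + min s t P(s - 1, t - 1))\<close> in the scanning time.

Pairs with \<open>\<bar>s - t\<bar> \<le> 1\<close> alone give \<open>P(n, n) \<ge> (\<alpha> + \<alpha>\<^sup>2)\<^sup>n\<close> at time \<open>1\<close>, which proves divergence.
For finiteness, bounding \<open>min s t + 1\<close> by \<open>(s + t + 2) / 2\<close> shows that \<open>\<Sum> P(s, t) / b ^ (s + t + 2)\<close> is
nonincreasing, where \<open>b\<^sup>2 = (1 - \<alpha> \<tau>)\<^sup>2 - \<alpha> \<tau>\<close> and \<open>\<tau>\<close> is the remaining time. Dividing \<open>[0, 1]\<close> into
columns replaces the differential equations by recursions.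
\<close>

section \<open>Vertices of the bump tree\<close>

lemma emeasure_bump_singleton:
  assumes s: "\<And>k. sets (\<xi> k) = sets unit_borel"
  shows "emeasure (bump \<xi> x k) {t} =
    (if t < x then emeasure (\<xi> (Suc k)) {t} else if x < t then emeasure (\<xi> k) {t} else 0)"
proof (cases "t \<in> {0..1}")
  case True
  then have "{t} \<in> sets unit_borel"
    by (auto simp: sets_restrict_space_iff)
  moreover have "{t} \<inter> {0..<x} = (if t < x then {t} else {})" "{t} \<inter> {x<..1} = (if x < t then {t} else {})"
    using True by auto
  ultimately show ?thesis
    by (simp add: emeasure_bump[OF s])
next
  \<comment> \<open>Outside \<open>{0..1}\<close> the singleton is not measurable, so
    \<open>emeasure\<close> takes its default value \<open>0\<close> on both sides.\<close>
  case False
  then have "{t} \<notin> sets unit_borel"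
    by (auto simp: sets_restrict_space_iff)
  then show ?thesis
    using s by (simp add: emeasure_notin_sets sets_bump)
qed

lemma sets_vertex_config:
  assumes "\<And>k. sets (\<xi> k) = sets unit_borel"
  shows "sets (vertex_config \<xi> v k) = sets unit_borel"
proof (cases v rule: rev_cases)
  case Nil
  with assms show ?thesis by (simp add: vertex_config_def)
next
  case (snoc w x)
  then show ?thesis by (simp add: vertex_config_def sets_bump)
qed

text \<open>A bump at \<open>x > t\<close> shifts the layers at \<open>t\<close> by one, a bump at
  \<open>x < t\<close> leaves them alone, and a bump at \<open>t\<close> itself deletes the atom
  there in every layer. Only the number of larger entries of \<open>v\<close> therefore
  matters.\<close>

lemma emeasure_vertex_config:
  assumes s: "\<And>k. sets (\<xi> k) = sets unit_borel"
  shows "emeasure (vertex_config \<xi> v k) {t} =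
    (if t \<in> set v then 0 else emeasure (\<xi> (k + length (filter (\<lambda>x. t < x) v))) {t})"
proof (induction v arbitrary: k rule: rev_induct)
  case Nil
  then show ?case by (simp add: vertex_config_def)
next
  case (snoc x v)
  have "vertex_config \<xi> (v @ [x]) = bump (vertex_config \<xi> v) x"
    by (simp add: vertex_config_def)
  then show ?case
    using snoc by (auto simp: emeasure_bump_singleton[OF sets_vertex_config[OF s]])
qed

lemma bump_tree_snoc_iff:
  assumes s: "\<And>k. sets (\<xi> k) = sets unit_borel"
  shows "v @ [x] \<in> bump_tree \<xi> \<longleftrightarrow>
    v \<in> bump_tree \<xi> \<and> x \<notin> set v \<and> x \<in> atoms (\<xi> (length (filter (\<lambda>z. x < z) v)))"
proof -
  have "v @ [x] \<in> bump_tree \<xi> \<longleftrightarrow> v \<in> bump_tree \<xi> \<and> x \<in> atoms (vertex_config \<xi> v 0)"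
    by (subst bump_tree.simps) auto
  then show ?thesis
    by (auto simp: atoms_def emeasure_vertex_config[OF s])
qed

lemma bump_tree_distinct:
  assumes s: "\<And>k. sets (\<xi> k) = sets unit_borel"
  shows "v \<in> bump_tree \<xi> \<Longrightarrow> distinct v"
proof (induction v rule: rev_induct)
  case (snoc x v)
  then show ?case unfolding bump_tree_snoc_iff[OF s] by simp
qed simp

lemma atoms_subset_unit:
  assumes "sets \<mu> = sets unit_borel"
  shows "atoms \<mu> \<subseteq> {0..1}"
proof
  fix x assume "x \<in> atoms \<mu>"
  then have "{x} \<in> sets \<mu>"
    using emeasure_notin_sets[of "{x}" \<mu>] unfolding atoms_def by (metis less_irrefl mem_Collect_eq)
  then show "x \<in> {0..1}"
    using assms by (auto simp: sets_restrict_space_iff)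
qed

lemma bump_tree_subset_unit:
  assumes s: "\<And>k. sets (\<xi> k) = sets unit_borel"
  shows "v \<in> bump_tree \<xi> \<Longrightarrow> set v \<subseteq> {0..1}"
proof (induction v rule: rev_induct)
  case (snoc x v)
  then have "set v \<subseteq> {0..1}" "x \<in> {0..1}"
    unfolding bump_tree_snoc_iff[OF s] using atoms_subset_unit[OF s] by blast+
  then show ?case by simp
qed simp

text \<open>The layer of an atom of a vertex is the number of larger atoms chosen before it. Hence
  a smallest atom can be removed without affecting the others, and its layer is its index.\<close>

lemma bump_tree_insert_Min_iff:
  assumes s: "\<And>k. sets (\<xi> k) = sets unit_borel" and y: "\<And>x. x \<in> set (u @ w) \<Longrightarrow> y < x"
  shows "u @ y # w \<in> bump_tree \<xi> \<longleftrightarrow> u @ w \<in> bump_tree \<xi> \<and> y \<in> atoms (\<xi> (length u))"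
  using y
proof (induction w rule: rev_induct)
  case Nil
  then have "filter (\<lambda>z. y < z) u = u"
    by (simp add: filter_id_conv)
  with Nil show ?case
    by (auto simp: bump_tree_snoc_iff[OF s])
next
  case (snoc z w)
  then have z: "y < z" and IH: "u @ y # w \<in> bump_tree \<xi> \<longleftrightarrow> u @ w \<in> bump_tree \<xi> \<and> y \<in> atoms (\<xi> (length u))"
    by auto
  have eq: "filter (\<lambda>x. z < x) (u @ y # w) = filter (\<lambda>x. z < x) (u @ w)"
    "z \<in> set (u @ y # w) \<longleftrightarrow> z \<in> set (u @ w)"
    using z by auto
  show ?case
    using bump_tree_snoc_iff[where \<xi> = \<xi> and v = "u @ y # w" and x = z, OF s]
      bump_tree_snoc_iff[where \<xi> = \<xi> and v = "u @ w" and x = z, OF s]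
    unfolding IH eq by auto
qed

section \<open>Columns\<close>

text \<open>Compactness argument: if no point of \<open>E\<close> is an atom, the measures of
  \<open>E\<close> intersected with shrinking balls around a point tend to \<open>0\<close>, and
  being natural numbers they reach \<open>0\<close>. Finitely many such balls cover
  \<open>{0..1}\<close>, so \<open>E\<close> is null. This turns an occupied cell into an atom that
  a vertex can use.\<close>

lemma integer_valued_measure_atom:
  assumes \<mu>: "integer_valued_measure \<mu>" and E: "E \<in> sets \<mu>" and pos: "emeasure \<mu> E \<noteq> 0"
  shows "\<exists>x\<in>E. x \<in> atoms \<mu>"
proof (rule ccontr)
  assume no: "\<not> (\<exists>x\<in>E. x \<in> atoms \<mu>)"
  have st: "sets \<mu> = sets unit_borel" and nat: "\<And>A. A \<in> sets \<mu> \<Longrightarrow> emeasure \<mu> A \<in> \<nat>"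
    using \<mu> by (auto simp: integer_valued_measure_def)
  have meas: "E \<inter> A \<in> sets \<mu>" if "open A" for A
    using E that by (auto simp: st sets_restrict_space_iff)
  have fin: "emeasure \<mu> A \<noteq> \<infinity>" if "A \<in> sets \<mu>" for A
    using nat[OF that] by (auto simp: Nats_def)
  have "\<exists>U. open U \<and> x \<in> U \<and> emeasure \<mu> (E \<inter> U) = 0" for x
  proof -
    let ?A = "\<lambda>n. E \<inter> ball x (1 / Suc n)"
    have "decseq ?A"
    proof (rule decseq_SucI)
      fix n
      have "1 / real (Suc (Suc n)) \<le> 1 / real (Suc n)" by (intro divide_left_mono) auto
      then show "?A (Suc n) \<subseteq> ?A n" using subset_ball by blast
    qed
    then have "(\<lambda>n. emeasure \<mu> (?A n)) \<longlonglongrightarrow> emeasure \<mu> (\<Inter>n. ?A n)"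
      using meas fin by (intro Lim_emeasure_decseq) auto
    moreover have "(\<Inter>n. ?A n) \<subseteq> E \<inter> {x}"
    proof
      fix z assume z: "z \<in> (\<Inter>n. ?A n)"
      have "dist x z \<le> 0"
      proof (rule field_le_epsilon)
        fix e :: real assume "e > 0"
        then obtain n where "1 / Suc n < e" using nat_approx_posE by blast
        then show "dist x z \<le> 0 + e" using z by (auto dest: spec[of _ n])
      qed
      then show "z \<in> E \<inter> {x}" using z by auto
    qed
    moreover have "emeasure \<mu> (E \<inter> {x}) = 0"
      using no by (cases "x \<in> E") (auto simp: atoms_def)
    moreover have "E \<inter> {x} \<in> sets \<mu>"
      using E by (auto simp: st sets_restrict_space_iff)
    ultimately have "(\<lambda>n. emeasure \<mu> (?A n)) \<longlonglongrightarrow> 0"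
      using emeasure_mono[of "\<Inter>n. ?A n" "E \<inter> {x}" \<mu>] by auto
    then have "eventually (\<lambda>n. emeasure \<mu> (?A n) < 1) sequentially"
      by (rule order_tendstoD) simp
    then obtain n where n: "emeasure \<mu> (?A n) < 1"
      by (auto simp: eventually_sequentially)
    moreover obtain k :: nat where "emeasure \<mu> (?A n) = of_nat k"
      using nat[OF meas[OF open_ball]] by (auto simp: Nats_def)
    ultimately have "emeasure \<mu> (?A n) = 0" by simp
    then show ?thesis by (intro exI[of _ "ball x (1 / Suc n)"]) auto
  qed
  then obtain U where U: "\<And>x. open (U x)" "\<And>x. x \<in> U x" "\<And>x. emeasure \<mu> (E \<inter> U x) = 0"
    by metis
  obtain F where F: "finite F" "{0..1} \<subseteq> (\<Union>x\<in>F. U x)"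
    using compactE_image[OF compact_Icc, of UNIV U "0::real" 1] U by (metis UNIV_I UN_I subsetI)
  have "E \<subseteq> {0..1}"
    using E by (auto simp: st sets_restrict_space_iff)
  then have "E \<subseteq> (\<Union>x\<in>F. E \<inter> U x)"
    using F(2) by blast
  then have "emeasure \<mu> E \<le> emeasure \<mu> (\<Union>x\<in>F. E \<inter> U x)"
    using meas[OF U(1)] F(1) by (intro emeasure_mono sets.finite_UN)
  also have "\<dots> \<le> (\<Sum>x\<in>F. emeasure \<mu> (E \<inter> U x))"
    using meas[OF U(1)] F(1) by (intro emeasure_subadditive_finite) auto
  finally show False
    using pos U(3) by simp
qed

text \<open>Columns are numbered from right to left. The truncated subtraction puts \<open>1\<close> into column \<open>0\<close>.\<close>

definition col_index :: "nat \<Rightarrow> real \<Rightarrow> nat" where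
  "col_index m x = nat \<lceil>real m * (1 - x)\<rceil> - 1"

definition cell :: "nat \<Rightarrow> nat \<Rightarrow> real set" where
  "cell m j = {x \<in> {0..1}. col_index m x = j}"

lemma col_index_less_imp_greater: "col_index m x < col_index m y \<Longrightarrow> y < x"
proof (rule ccontr)
  assume *: "col_index m x < col_index m y" "\<not> y < x"
  then have "real m * (1 - y) \<le> real m * (1 - x)" by (intro mult_left_mono) auto
  then have "col_index m y \<le> col_index m x"
    unfolding col_index_def by (intro diff_le_mono nat_mono ceiling_mono)
  with * show False by simp
qed

lemma col_index_less:
  assumes "x \<in> {0..1}" "0 < m"
  shows "col_index m x < m"
proof -
  have "real m * (1 - x) \<le> real m" using assms by (simp add: mult_left_le)
  then have "\<lceil>real m * (1 - x)\<rceil> \<le> int m" by (simp add: ceiling_le_iff)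
  then show ?thesis using assms unfolding col_index_def by linarith
qed

lemma eventually_inj_on_col_index:
  assumes "finite P" "P \<subseteq> {0..1}"
  shows "eventually (\<lambda>m. inj_on (col_index m) P) sequentially"
proof -
  have "eventually (\<lambda>m. col_index m x \<noteq> col_index m y) sequentially"
    if "x \<in> P" "y \<in> P" "x < y" for x y
  proof -
    have "eventually (\<lambda>m. 1 / (y - x) < real m) sequentially"
      using filterlim_real_sequentially by (simp add: filterlim_at_top_dense)
    then show ?thesis
    proof eventually_elim
      case (elim m)
      then have "real m * (1 - y) + 1 < real m * (1 - x)"
        using that by (simp add: field_simps)
      moreover have "0 \<le> real m * (1 - y)" using that assms by auto
      \<comment> \<open>The bound \<open>2 \<le>\<close> is essential: \<open>col_index\<close>
        sends the ceilings \<open>0\<close> and \<open>1\<close> to the same column, so distinct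
        ceilings alone do not separate the points.\<close>
      ultimately have "nat \<lceil>real m * (1 - y)\<rceil> < nat \<lceil>real m * (1 - x)\<rceil>" "2 \<le> nat \<lceil>real m * (1 - x)\<rceil>"
        by linarith+
      then show ?case unfolding col_index_def by linarith
    qed
  qed
  then have "eventually (\<lambda>m. \<forall>x\<in>P. \<forall>y\<in>P. x < y \<longrightarrow> col_index m x \<noteq> col_index m y) sequentially"
    using assms by (intro eventually_ball_finite ballI) (auto intro: eventually_mono)
  then show ?thesis
    by eventually_elim (metis inj_onI linorder_neqE)
qed

lemma cell_eq:
  assumes "j < m"
  shows "cell m j = (if j = 0 then {1 - 1 / real m..1} else {1 - real (j + 1) / real m..<1 - real j / real m})"
proof (rule set_eqI)
  fix x :: real
  have m: "real m > 0" using assms by simp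
  have "x \<in> cell m j \<longleftrightarrow> 0 \<le> 1 - x \<and> 1 - x \<le> 1 \<and> nat \<lceil>real m * (1 - x)\<rceil> - 1 = j"
    by (auto simp: cell_def col_index_def)
  also have "\<dots> \<longleftrightarrow> 0 \<le> 1 - x \<and> 1 - x \<le> 1 \<and>
      (if j = 0 then real m * (1 - x) \<le> 1 else real j < real m * (1 - x) \<and> real m * (1 - x) \<le> real (j + 1))"
  proof -
    have "nat \<lceil>z\<rceil> - 1 = j \<longleftrightarrow> (if j = 0 then z \<le> 1 else real j < z \<and> z \<le> real (j + 1))" for z :: real
      by (auto; linarith)
    then show ?thesis by simp
  qed
  also have "\<dots> \<longleftrightarrow> (if j = 0 then 0 \<le> 1 - x \<and> 1 - x \<le> 1 / real m else real j / real m < 1 - x \<and> 1 - x \<le> real (j + 1) / real m)"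
  proof -
    have "real (j + 1) / real m \<le> 1" "0 \<le> real j / real m" "1 / real m \<le> 1" using assms by auto
    moreover have "real j < real m * (1 - x) \<longleftrightarrow> real j / real m < 1 - x"
      "real m * (1 - x) \<le> real (j + 1) \<longleftrightarrow> 1 - x \<le> real (j + 1) / real m"
      "real m * (1 - x) \<le> 1 \<longleftrightarrow> 1 - x \<le> 1 / real m"
      using m by (simp_all add: field_simps)
    ultimately show ?thesis
      by (smt (verit))
  qed
  finally show "x \<in> cell m j \<longleftrightarrow> x \<in> (if j = 0 then {1 - 1 / real m..1} else {1 - real (j + 1) / real m..<1 - real j / real m})"
    by auto
qed

lemma cell_empty: "0 < m \<Longrightarrow> m \<le> j \<Longrightarrow> cell m j = {}"
  using col_index_less[of _ m] unfolding cell_def by (metis (mono_tags, lifting) empty_Collect_eq leD)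

lemma cell_in_sets:
  assumes "0 < m"
  shows "cell m j \<in> sets unit_borel"
proof -
  have "cell m j \<in> sets borel"
    using assms by (cases "j < m") (auto simp: cell_eq cell_empty)
  then show ?thesis
    by (auto simp: sets_restrict_space_iff cell_def)
qed

lemma measure_cell: "j < m \<Longrightarrow> measure lborel (cell m j) = 1 / m"
proof (cases "j = 0")
  case False
  assume "j < m"
  moreover have "1 - real (j + 1) / real m \<le> 1 - real j / real m"
    by (intro diff_left_mono divide_right_mono) auto
  ultimately show ?thesis
    using False by (simp only: cell_eq if_False measure_lborel_Ico) (simp add: add_divide_distrib)
qed (simp add: cell_eq)

text \<open>Counts vertices with \<open>s\<close> entries in the first \<open>j\<close> columns when
  every occupied pair of column and layer supplies one point and each column is used at most once.
  The second summand inserts a new smallest entry into a list of length \<open>s - 1\<close> at an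
  index \<open>k < s\<close>, which is its layer. For \<open>s = 0\<close> the factor
  \<open>card\<close> vanishes, so the truncated subtraction is harmless.\<close>

fun discrete_count :: "(nat \<Rightarrow> nat \<Rightarrow> bool) \<Rightarrow> nat \<Rightarrow> nat \<Rightarrow> nat" where
  "discrete_count X 0 s = of_bool (s = 0)"
| "discrete_count X (Suc j) s =
     discrete_count X j s + card {k. k < s \<and> X j k} * discrete_count X j (s - 1)"

definition occupied :: "configuration \<Rightarrow> nat \<Rightarrow> nat \<Rightarrow> nat \<Rightarrow> bool" where
  "occupied \<xi> m j k \<longleftrightarrow> emeasure (\<xi> k) (cell m j) \<noteq> 0"

text \<open>Induction over the columns: one atom is fixed in each occupied cell of column
  \<open>j\<close> and inserted at the index given by its layer. The insertion is injective, because
  the new entry is the only one in column \<open>j\<close>: its position gives back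
  \<open>k\<close>, and deleting it gives back \<open>v\<close>. Lists with and without an entry in
  column \<open>j\<close> are disjoint.\<close>

lemma discrete_count_le_card_bump_tree:
  assumes \<xi>: "\<And>k. integer_valued_measure (\<xi> k)" and m: "0 < m"
  shows "\<exists>B \<subseteq> {v \<in> bump_tree \<xi>. length v = s \<and> (\<forall>x\<in>set v. col_index m x < j)}.
    finite B \<and> card B = discrete_count (occupied \<xi> m) j s"
proof (induction j arbitrary: s)
  case 0
  then show ?case
    using bump_tree.root by (intro exI[of _ "if s = 0 then {[]} else {}"]) simp
next
  case (Suc j)
  let ?R = "\<lambda>j s. {v \<in> bump_tree \<xi>. length v = s \<and> (\<forall>x\<in>set v. col_index m x < j)}"
  let ?K = "{k. k < s \<and> occupied \<xi> m j k}"
  have sets: "\<And>k. sets (\<xi> k) = sets unit_borel"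
    using \<xi> by (simp add: integer_valued_measure_def)
  have "\<exists>y \<in> cell m j. y \<in> atoms (\<xi> k)" if "k \<in> ?K" for k
    using that integer_valued_measure_atom[OF \<xi>] cell_in_sets[OF m] sets by (auto simp: occupied_def)
  then obtain y where y: "\<And>k. k \<in> ?K \<Longrightarrow> col_index m (y k) = j \<and> y k \<in> atoms (\<xi> k)"
    unfolding cell_def by (simp add: Bex_def) metis
  obtain B where B: "B \<subseteq> ?R j s" "finite B" "card B = discrete_count (occupied \<xi> m) j s"
    using Suc[of s] by blast
  obtain C where C: "C \<subseteq> ?R j (s - 1)" "finite C" "card C = discrete_count (occupied \<xi> m) j (s - 1)"
    using Suc[of "s - 1"] by blast
  \<comment> \<open>Columns run from right to left, so \<open>y k\<close> is smaller than all
    entries of \<open>v\<close>, and \<open>bump_tree_insert_Min_iff\<close> applies with layer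
    \<open>k\<close>.\<close>
  define g where "g = (\<lambda>(k, v). take k v @ y k # drop k v)"
  have g: "g (k, v) \<in> ?R (Suc j) s" "col_index m (g (k, v) ! k) = j"
      "take k (g (k, v)) @ drop (Suc k) (g (k, v)) = v"
      "\<And>i. i < length (g (k, v)) \<Longrightarrow> col_index m (g (k, v) ! i) = j \<Longrightarrow> i = k"
    if kv: "k \<in> ?K" "v \<in> C" for k v
  proof -
    have v: "v \<in> bump_tree \<xi>" "length v = s - 1" "\<And>x. x \<in> set v \<Longrightarrow> col_index m x < j"
      using kv C by auto
    have k: "k \<le> length v" "Suc (length v) = s" using kv v by auto
    have "y k < x" if "x \<in> set v" for x
      using v(3)[OF that] y[OF kv(1)] by (intro col_index_less_imp_greater[of m]) auto
    then have "g (k, v) \<in> bump_tree \<xi>"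
      using y[OF kv(1)] v(1) k unfolding g_def prod.case
      by (subst bump_tree_insert_Min_iff[OF sets]) (auto simp: min_absorb2)
    then show "g (k, v) \<in> ?R (Suc j) s"
      using v(3) k y[OF kv(1)] by (auto simp: g_def less_Suc_eq dest: in_set_takeD in_set_dropD)
    show "col_index m (g (k, v) ! k) = j"
      using y[OF kv(1)] k by (simp add: g_def nth_append)
    show "take k (g (k, v)) @ drop (Suc k) (g (k, v)) = v"
      using k by (simp add: g_def)
    show "i = k" if i: "i < length (g (k, v))" "col_index m (g (k, v) ! i) = j" for i
    proof (rule ccontr)
      assume "i \<noteq> k"
      then have "g (k, v) ! i \<in> set v"
        using i(1) k by (auto simp: g_def nth_append nth_Cons' in_set_conv_nth
            intro!: exI[of _ "if i < k then i else i - 1"])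
      then show False using v(3) i(2) by fastforce
    qed
  qed
  have "inj_on g (?K \<times> C)"
  proof (rule inj_onI, clarify)
    fix k v k' v'
    assume *: "k < s" "occupied \<xi> m j k" "v \<in> C" "k' < s" "occupied \<xi> m j k'" "v' \<in> C" "g (k, v) = g (k', v')"
    then have K: "k \<in> ?K" "k' \<in> ?K" by auto
    have "length (g (k, v)) = s" using g(1)[OF K(1) *(3)] by auto
    then have "k = k'"
      using g(4)[OF K(2) *(6), of k] g(2)[OF K(1) *(3)] * by auto
    have e: "g (k', v) = g (k', v')"
      using *(7) unfolding \<open>k = k'\<close> .
    have "v = v'"
      using g(3)[OF K(1) *(3)] g(3)[OF K(2) *(6)] unfolding e \<open>k = k'\<close> by (rule trans[OF sym])
    with \<open>k = k'\<close> show "k = k' \<and> v = v'" ..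
  qed
  then have "card (g ` (?K \<times> C)) = card ?K * card C"
    by (simp add: card_image card_cartesian_product)
  moreover have "B \<inter> g ` (?K \<times> C) = {}"
  proof -
    have "g (k, v) \<notin> B" if kv: "k \<in> ?K" "v \<in> C" for k v
    proof
      assume "g (k, v) \<in> B"
      then have "\<forall>x\<in>set (g (k, v)). col_index m x < j" "k < length (g (k, v))"
        using B kv by auto
      then show False using g(2)[OF kv] nth_mem by fastforce
    qed
    then show ?thesis by auto
  qed
  ultimately have "card (B \<union> g ` (?K \<times> C)) = discrete_count (occupied \<xi> m) (Suc j) s"
    using B C by (subst card_Un_disjoint) auto
  moreover have "B \<subseteq> ?R (Suc j) s"
    using B(1) by (auto intro: less_SucI)
  moreover have "g ` (?K \<times> C) \<subseteq> ?R (Suc j) s"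
    using g(1) by blast
  ultimately show ?case
    using B(2) C(2) by (intro exI[of _ "B \<union> g ` (?K \<times> C)"] conjI Un_least) (auto intro!: finite_imageI)
qed

text \<open>Once the columns separate the points of \<open>P\<close>, a vertex has at most one entry
  in column \<open>j\<close>. If there is one, it is the smallest entry; removing it leaves a vertex
  in the earlier columns, and its index is a layer in which the cell is occupied.\<close>

lemma card_bump_tree_le_discrete_count:
  assumes \<xi>: "\<And>k. integer_valued_measure (\<xi> k)" and m: "0 < m"
    and P: "finite P" and inj: "inj_on (col_index m) P"
  defines "R \<equiv> \<lambda>j s. {v \<in> bump_tree \<xi>. length v = s \<and> set v \<subseteq> P \<and> (\<forall>x\<in>set v. col_index m x < j)}"
  shows "finite (R j s) \<and> card (R j s) \<le> discrete_count (occupied \<xi> m) j s"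
proof (induction j arbitrary: s)
  case 0
  have "R 0 s \<subseteq> (if s = 0 then {[]} else {})" by (auto simp: R_def)
  moreover have "finite (if s = 0 then {[]} else {})"
    "card (if s = 0 then {[]} else {}) = discrete_count (occupied \<xi> m) 0 s" by auto
  ultimately show ?case
    by (metis card_mono finite_subset)
next
  case (Suc j)
  let ?K = "{k. k < s \<and> occupied \<xi> m j k}"
  have sets: "\<And>k. sets (\<xi> k) = sets unit_borel"
    using \<xi> by (simp add: integer_valued_measure_def)
  \<comment> \<open>If column \<open>j\<close> contains no point of \<open>P\<close>, then
    \<open>y\<close> is arbitrary. The image under \<open>g\<close> then only enlarges the covering
    set.\<close>
  define y where "y = (THE y. y \<in> P \<and> col_index m y = j)"
  define g where "g = (\<lambda>(k, v). take k v @ y # drop k v)"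
  have "R (Suc j) s \<subseteq> R j s \<union> g ` (?K \<times> R j (s - 1))"
  proof
    fix v assume v: "v \<in> R (Suc j) s"
    show "v \<in> R j s \<union> g ` (?K \<times> R j (s - 1))"
    proof (cases "\<forall>x\<in>set v. col_index m x < j")
      case True
      then show ?thesis using v by (auto simp: R_def)
    next
      case False
      then obtain x where x: "x \<in> set v" "col_index m x = j"
        using v by (auto simp: R_def less_Suc_eq)
      then have xP: "x \<in> P" using v by (auto simp: R_def)
      then have "y = x"
        unfolding y_def using x inj by (intro the_equality) (auto dest: inj_onD)
      obtain u w where uw: "v = u @ y # w" using x \<open>y = x\<close> by (metis split_list)
      have "distinct v" using v bump_tree_distinct[OF sets] by (auto simp: R_def)
      have less: "col_index m z < j" if "z \<in> set (u @ w)" for z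
      proof -
        have "z \<noteq> x" "z \<in> P" "col_index m z < Suc j"
          using that \<open>distinct v\<close> \<open>y = x\<close> v by (auto simp: uw R_def)
        then show ?thesis using inj xP x(2) by (auto simp: less_Suc_eq dest: inj_onD)
      qed
      then have "y < z" if "z \<in> set (u @ w)" for z
        using that x(2) \<open>y = x\<close> by (intro col_index_less_imp_greater[of m]) auto
      then have *: "u @ w \<in> bump_tree \<xi>" "y \<in> atoms (\<xi> (length u))"
        using v bump_tree_insert_Min_iff[OF sets, of u w y] by (auto simp: R_def uw)
      have "y \<in> cell m j"
        using subsetD[OF atoms_subset_unit[OF sets] *(2)] x(2) \<open>y = x\<close> by (simp add: cell_def)
      then have "emeasure (\<xi> (length u)) {y} \<le> emeasure (\<xi> (length u)) (cell m j)"
        using sets cell_in_sets[OF m] by (intro emeasure_mono) auto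
      then have "length u \<in> ?K"
        using *(2) v by (auto simp: occupied_def atoms_def R_def uw)
      moreover have "u @ w \<in> R j (s - 1)"
        using *(1) less v by (auto simp: R_def uw)
      moreover have "v = g (length u, u @ w)" by (simp add: g_def uw)
      ultimately show ?thesis by (intro UnI2 image_eqI) auto
    qed
  qed
  moreover have fin: "finite (R j s \<union> g ` (?K \<times> R j (s - 1)))"
    using Suc by auto
  ultimately have "card (R (Suc j) s) \<le> card (R j s \<union> g ` (?K \<times> R j (s - 1)))" "finite (R (Suc j) s)"
    by (auto intro: card_mono finite_subset)
  moreover have "card (R j s \<union> g ` (?K \<times> R j (s - 1))) \<le> card (R j s) + card (g ` (?K \<times> R j (s - 1)))"
    by (rule card_Un_le)
  moreover have "card (g ` (?K \<times> R j (s - 1))) \<le> card ?K * card (R j (s - 1))"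
    using card_image_le[of "?K \<times> R j (s - 1)" g] Suc by (simp add: card_cartesian_product)
  moreover have "card ?K * card (R j (s - 1)) \<le> card ?K * discrete_count (occupied \<xi> m) j (s - 1)"
    using Suc by simp
  ultimately show ?case
    using conjunct2[OF Suc[of s]] unfolding discrete_count.simps by linarith
qed

section \<open>The expected number of pairs of vertices\<close>

text \<open>The expected product of the counts for \<open>s\<close> and \<open>t\<close> when
  distinct pairs of column and layer are occupied independently with probability \<open>p\<close>.
  In the last term both vertices use column \<open>j\<close>; \<open>card {k, l}\<close> is
  \<open>1\<close> or \<open>2\<close> according to whether they use the same layer.\<close>

fun pair_mean :: "real \<Rightarrow> nat \<Rightarrow> nat \<Rightarrow> nat \<Rightarrow> real" where
  "pair_mean p 0 s t = of_bool (s = 0 \<and> t = 0)"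
| "pair_mean p (Suc j) s t = pair_mean p j s t
     + real s * p * pair_mean p j (s - 1) t + real t * p * pair_mean p j s (t - 1)
     + (\<Sum>k<s. \<Sum>l<t. p ^ card {k, l}) * pair_mean p j (s - 1) (t - 1)"

lemma pair_mean_nonneg: "0 \<le> p \<Longrightarrow> 0 \<le> pair_mean p j s t"
  by (induction p j s t rule: pair_mean.induct) (auto intro!: add_nonneg_nonneg mult_nonneg_nonneg sum_nonneg)

lemma sum_diagonal: "(\<Sum>k<s. \<Sum>l<t. if k = l then p else 0) = real (min s t) * p"
proof -
  have "(\<Sum>k<s. \<Sum>l<t. if k = l then p else 0) = (\<Sum>k<s. if k < t then p else 0)"
    by (simp add: sum.delta)
  also have "\<dots> = real (card ({..<s} \<inter> {k. k < t})) * p"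
    by (simp add: sum.If_cases)
  also have "{..<s} \<inter> {k. k < t} = {..<min s t}" by auto
  finally show ?thesis by simp
qed

text \<open>The diagonal \<open>k = l\<close> is the part of first order in \<open>p\<close>. The
  remaining terms are of second order and disappear as the columns become fine, so the lower bound
  drops them.\<close>

lemma sum_power_card_pair_ge:
  assumes "0 \<le> p"
  shows "real (min s t) * p \<le> (\<Sum>k<s. \<Sum>l<t. p ^ card {k, l})"
  unfolding sum_diagonal[symmetric]
  using assms by (intro sum_mono) auto

lemma sum_power_card_pair_le:
  assumes "0 \<le> p"
  shows "(\<Sum>k<s. \<Sum>l<t. p ^ card {k, l}) \<le> real (min s t) * p + real s * real t * p\<^sup>2"
proof -
  have "(\<Sum>k<s. \<Sum>l<t. p ^ card {k, l}) \<le> (\<Sum>k<s. \<Sum>l<t. (if k = l then p else 0) + p\<^sup>2)"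
    using assms by (intro sum_mono) (auto simp: card_insert_if power2_eq_square)
  then show ?thesis
    by (simp only: sum.distrib sum_diagonal) (simp add: mult.assoc)
qed

section \<open>Lower bound from pairs of nearly equal length\<close>

definition off_diagonal :: "real \<Rightarrow> nat \<Rightarrow> nat \<Rightarrow> real" where
  "off_diagonal p j n = pair_mean p j (Suc n) n + pair_mean p j n (Suc n)"

text \<open>Together with \<open>off_diagonal_step\<close> this forms a closed system of
  inequalities for pairs whose lengths differ by at most one. Adding the two orders in
  \<open>off_diagonal\<close> merges the two terms of the recursion that have the common factor
  \<open>Suc n * p\<close>.\<close>

lemma pair_mean_diagonal_step:
  fixes p :: real
  assumes "0 \<le> p"
  shows "pair_mean p j (Suc n) (Suc n) + Suc n * p * (pair_mean p j n n + off_diagonal p j n)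
    \<le> pair_mean p (Suc j) (Suc n) (Suc n)"
proof -
  have "real (min (Suc n) (Suc n)) * p * pair_mean p j n n
      \<le> (\<Sum>k<Suc n. \<Sum>l<Suc n. p ^ card {k, l}) * pair_mean p j n n"
    using assms by (intro mult_right_mono sum_power_card_pair_ge pair_mean_nonneg)
  then show ?thesis
    by (simp add: off_diagonal_def algebra_simps del: sum.lessThan_Suc)
qed

lemma pair_mean_mono_step:
  assumes "0 \<le> p"
  shows "pair_mean p j s t \<le> pair_mean p (Suc j) s t"
  using assms by (auto intro!: add_increasing2 mult_nonneg_nonneg sum_nonneg pair_mean_nonneg)

text \<open>The terms with lengths differing by two or more are nonnegative and are discarded. The
  factor \<open>2\<close> comes from the two orders of the pair.\<close>

lemma off_diagonal_step:
  fixes p :: real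
  assumes "0 \<le> p"
  shows "off_diagonal p j n + 2 * Suc n * p * pair_mean p j n n + n * p * off_diagonal p j (n - 1)
    \<le> off_diagonal p (Suc j) n"
proof -
  have *: "real n * p * pair_mean p j s t \<le> (\<Sum>k<s'. \<Sum>l<t'. p ^ card {k, l}) * pair_mean p j s t"
    if "min s' t' = n" for s t s' t'
    using that sum_power_card_pair_ge[OF assms, of s' t'] assms by (intro mult_right_mono pair_mean_nonneg) auto
  have "0 \<le> real n * p * pair_mean p j (Suc n) (n - 1)" "0 \<le> real n * p * pair_mean p j (n - 1) (Suc n)"
    using assms by (auto intro!: mult_nonneg_nonneg pair_mean_nonneg)
  moreover have "n * p * off_diagonal p j (n - 1) = n * p * pair_mean p j n (n - 1) + n * p * pair_mean p j (n - 1) n"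
    by (cases n) (simp_all add: off_diagonal_def algebra_simps)
  ultimately show ?thesis
    using *[of "Suc n" n n "n - 1"] *[of n "Suc n" "n - 1" n]
    by (simp add: off_diagonal_def algebra_simps del: sum.lessThan_Suc)
qed

text \<open>In the limit \<open>p \<rightarrow> 0\<close>, the functions \<open>\<phi>\<^sup>n\<close> and \<open>2x\<phi>\<^sup>n\<close> with \<open>\<phi>(x) = x + x\<^sup>2\<close> are, for \<open>x \<le> 1\<close>,
  a subsolution of the recursions above; delaying the time by two steps per point
  makes this exact for positive \<open>p\<close>.\<close>

lemma power_diff_le:
  fixes a b :: real
  assumes "0 \<le> b" "b \<le> a"
  shows "a ^ Suc n - b ^ Suc n \<le> Suc n * a ^ n * (a - b)"
proof -
  have "a ^ Suc n - b ^ Suc n = (a - b) * (\<Sum>i<Suc n. a ^ i * b ^ (n - i))"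
    by (subst power_diff_sumr2) (simp add: mult.commute del: power_Suc)
  also have "\<dots> \<le> (a - b) * (\<Sum>i<Suc n. a ^ n)"
  proof (intro mult_left_mono sum_mono)
    fix i assume "i \<in> {..<Suc n}"
    then have "a ^ i * a ^ (n - i) = a ^ n"
      by (simp add: power_add[symmetric])
    moreover have "a ^ i * b ^ (n - i) \<le> a ^ i * a ^ (n - i)"
      using assms by (intro mult_left_mono power_mono) auto
    ultimately show "a ^ i * b ^ (n - i) \<le> a ^ n" by simp
  qed (use assms in auto)
  finally show ?thesis by (simp add: algebra_simps)
qed

text \<open>A discrete form of the derivative \<open>(n + 1) * \<phi> ^ n * (1 + 2 * x)\<close> of
  the power \<open>n + 1\<close> of \<phi>. Evaluating it at the right endpoint \<open>y\<close>
  gives an upper bound by monotonicity.\<close>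

lemma phi_power_step:
  fixes x y p :: real
  assumes "0 \<le> x" "0 \<le> p"
  defines "y \<equiv> x + p"
  shows "(y + y\<^sup>2) ^ Suc n - (x + x\<^sup>2) ^ Suc n \<le> Suc n * p * ((y + y\<^sup>2) ^ n + (y + y\<^sup>2) ^ n * (2 * y))"
proof -
  have "(y + y\<^sup>2) ^ Suc n - (x + x\<^sup>2) ^ Suc n \<le> Suc n * (y + y\<^sup>2) ^ n * ((y + y\<^sup>2) - (x + x\<^sup>2))"
    using assms by (intro power_diff_le add_mono power_mono) auto
  also have "\<dots> \<le> Suc n * (y + y\<^sup>2) ^ n * (p * (1 + 2 * y))"
    using assms by (intro mult_left_mono) (auto simp: power2_eq_square algebra_simps)
  finally show ?thesis by (simp add: algebra_simps)
qed

text \<open>The product rule for \<open>\<phi> ^ n * (2 * x)\<close>, again with the right endpoint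
  as upper bound. The estimate
  \<open>(1 + 2 * y) * (2 * y) \<le> 2 * (y + y\<^sup>2) + 2 * y\<close> amounts to
  \<open>y\<^sup>2 \<le> y\<close>, which is where time at most \<open>1\<close> enters.\<close>

lemma phi_psi_step:
  fixes x y p :: real
  assumes "0 \<le> x" "0 \<le> p" "x + p \<le> 1"
  defines "y \<equiv> x + p"
  shows "(y + y\<^sup>2) ^ n * (2 * y) - (x + x\<^sup>2) ^ n * (2 * x)
    \<le> p * (2 * Suc n * (y + y\<^sup>2) ^ n + n * ((y + y\<^sup>2) ^ (n - 1) * (2 * y)))"
proof (cases n)
  case 0
  then show ?thesis by (simp add: y_def)
next
  case (Suc k)
  define f where "f = (y + y\<^sup>2) ^ k"
  have y: "0 \<le> y" "y \<le> 1" "x \<le> y" and f: "0 \<le> f" "f * (y + y\<^sup>2) = (y + y\<^sup>2) ^ n"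
    using assms by (auto simp: f_def Suc)
  have "((y + y\<^sup>2) ^ n - (x + x\<^sup>2) ^ n) * (2 * x) \<le> (n * p * (f + f * (2 * y))) * (2 * y)"
    using phi_power_step[OF assms(1,2), of k] y f assms(1,2)
    by (intro mult_mono) (auto simp: f_def Suc y_def intro!: mult_nonneg_nonneg)
  also have "\<dots> = p * n * f * ((1 + 2 * y) * (2 * y))"
    by (simp add: algebra_simps)
  also have "\<dots> \<le> p * n * f * (2 * (y + y\<^sup>2) + 2 * y)"
  proof (intro mult_left_mono)
    have "y * y \<le> y * 1" using y by (intro mult_left_mono) auto
    then show "(1 + 2 * y) * (2 * y) \<le> 2 * (y + y\<^sup>2) + 2 * y"
      by (simp add: power2_eq_square algebra_simps)
  qed (use f assms in auto)
  also have "\<dots> = p * (2 * n * (f * (y + y\<^sup>2)) + n * (f * (2 * y)))"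
    by (simp add: algebra_simps)
  finally have "((y + y\<^sup>2) ^ n - (x + x\<^sup>2) ^ n) * (2 * x) \<le> p * (2 * n * (y + y\<^sup>2) ^ n + n * (f * (2 * y)))"
    unfolding f(2) .
  moreover have "(y + y\<^sup>2) ^ n * (2 * y) = (y + y\<^sup>2) ^ n * (2 * x) + 2 * p * (y + y\<^sup>2) ^ n"
    by (simp add: y_def algebra_simps)
  ultimately show ?thesis
    by (simp add: f_def Suc algebra_simps)
qed

text \<open>The increments of the comparison functions are bounded by values at the later time
  \<open>y\<close>, whereas the recursion supplies values at column \<open>j\<close>. The delays
  \<open>2 * n\<close> and \<open>2 * n + 1\<close> compensate: every term on the right has at most
  the delay that makes its time reach \<open>y\<close>. Before the delay has elapsed, truncated
  subtraction gives time \<open>0\<close>, and the bound is \<open>0\<close> except on the diagonal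
  with \<open>n = 0\<close>.\<close>

lemma pair_mean_lower:
  assumes p: "0 \<le> p" and "p * real j \<le> 1"
  shows "(let x = p * real (j - 2 * n) in (x + x\<^sup>2) ^ n) \<le> pair_mean p j n n \<and>
    (let x = p * real (j - (2 * n + 1)) in (x + x\<^sup>2) ^ n * (2 * x)) \<le> off_diagonal p j n"
  using assms(2)
proof (induction j arbitrary: n)
  case 0
  show ?case by (cases n) (auto simp: off_diagonal_def)
next
  case (Suc j)
  have le: "p * real j \<le> 1"
    using p Suc.prems by (simp add: algebra_simps)
  have IH: "(p * real (j - 2 * n) + (p * real (j - 2 * n))\<^sup>2) ^ n \<le> pair_mean p j n n"
    "(p * real (j - (2 * n + 1)) + (p * real (j - (2 * n + 1)))\<^sup>2) ^ n * (2 * (p * real (j - (2 * n + 1))))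
      \<le> off_diagonal p j n" for n
    using Suc.IH[OF le, of n] by (simp_all add: Let_def)
  show ?case
  proof
    show "(let x = p * real (Suc j - 2 * n) in (x + x\<^sup>2) ^ n) \<le> pair_mean p (Suc j) n n"
    proof (cases n)
      case 0
      then show ?thesis
        using IH(1)[of 0] pair_mean_mono_step[OF p, of j 0 0] by simp
    next
      case n: (Suc i)
      show ?thesis
      proof (cases "Suc j \<le> 2 * n")
        case True
        then show ?thesis
          using pair_mean_nonneg[OF p] n by (simp add: Let_def del: pair_mean.simps)
      next
        case False
        define x where "x = p * real (j - 2 * n)"
        define y where "y = x + p"
        have x: "0 \<le> x" using p by (simp add: x_def)
        \<comment> \<open>Delay \<open>2 * n\<close> at column \<open>Suc j\<close> and delay
          \<open>2 * i + 1\<close> at column \<open>j\<close> give the same time, since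
          \<open>n = Suc i\<close>.\<close>
        have y: "y = p * real (Suc j - 2 * n)" "y = p * real (j - (2 * i + 1))"
          using False by (simp_all add: y_def x_def n algebra_simps of_nat_diff)
        have "y \<le> p * real (j - 2 * i)"
          using p unfolding y(2) by (intro mult_left_mono) auto
        then have "(y + y\<^sup>2) ^ i \<le> pair_mean p j i i"
          using x p by (intro order.trans[OF _ IH(1)] power_mono add_mono) (auto simp: y_def)
        then have "Suc i * p * ((y + y\<^sup>2) ^ i + (y + y\<^sup>2) ^ i * (2 * y))
            \<le> Suc i * p * (pair_mean p j i i + off_diagonal p j i)"
          using IH(2)[of i] p unfolding y(2)[symmetric] by (intro mult_left_mono add_mono) auto
        then show ?thesis
          using phi_power_step[OF x p, of i] IH(1)[of n] pair_mean_diagonal_step[OF p, of j i]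
          unfolding Let_def n y(1)[unfolded n, symmetric] x_def[unfolded n, symmetric] y_def[symmetric]
          by linarith
      qed
    qed
  next
    show "(let x = p * real (Suc j - (2 * n + 1)) in (x + x\<^sup>2) ^ n * (2 * x)) \<le> off_diagonal p (Suc j) n"
    proof (cases "Suc j \<le> 2 * n + 1")
      case True
      then show ?thesis
        using pair_mean_nonneg[OF p] by (simp add: Let_def off_diagonal_def del: pair_mean.simps)
    next
      case False
      define x where "x = p * real (j - (2 * n + 1))"
      define y where "y = x + p"
      have x: "0 \<le> x" using p by (simp add: x_def)
      have y: "y = p * real (Suc j - (2 * n + 1))" "y = p * real (j - 2 * n)"
        using False by (simp_all add: y_def x_def algebra_simps of_nat_diff)
      have "y \<le> p * real (Suc j)" using p unfolding y(1) by (intro mult_left_mono) auto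
      then have y1: "x + p \<le> 1" using Suc.prems by (simp add: y_def)
      have "n * ((y + y\<^sup>2) ^ (n - 1) * (2 * y)) \<le> n * off_diagonal p j (n - 1)"
      proof (cases n)
        case (Suc i)
        have "y \<le> p * real (j - (2 * i + 1))"
          using p unfolding y(2) Suc by (intro mult_left_mono) auto
        then have "(y + y\<^sup>2) ^ i * (2 * y) \<le> off_diagonal p j i"
          using x p by (intro order.trans[OF _ IH(2)] mult_mono power_mono add_mono) (auto simp: y_def)
        then show ?thesis by (simp add: Suc del: of_nat_Suc)
      qed simp
      moreover have "2 * Suc n * (y + y\<^sup>2) ^ n \<le> 2 * Suc n * pair_mean p j n n"
        using IH(1)[of n] unfolding y(2)[symmetric] by (intro mult_left_mono) auto
      ultimately have "p * (2 * Suc n * (y + y\<^sup>2) ^ n + n * ((y + y\<^sup>2) ^ (n - 1) * (2 * y)))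
          \<le> p * (2 * Suc n * pair_mean p j n n + n * off_diagonal p j (n - 1))"
        using p by (intro mult_left_mono[OF add_mono])
      also have "\<dots> = 2 * Suc n * p * pair_mean p j n n + n * p * off_diagonal p j (n - 1)"
        by (simp add: algebra_simps)
      finally show ?thesis
        using phi_psi_step[OF x p y1, of n] IH(2)[of n] off_diagonal_step[OF p, of j n]
        unfolding Let_def y(1)[symmetric] x_def[symmetric] y_def[symmetric] by linarith
    qed
  qed
qed

section \<open>Upper bound from a weighted sum\<close>

lemma sum_le_sum_Suc:
  fixes f :: "nat \<Rightarrow> real"
  assumes "f 0 = 0" "0 \<le> f (Suc N)"
  shows "(\<Sum>s\<le>N. f s) \<le> (\<Sum>s\<le>N. f (Suc s))"
  using assms sum.atMost_Suc_shift[of f N] by simp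

text \<open>In one step each \<open>P(s, t)\<close> acquires the factor \<open>1 + Suc s * h * r' +
  Suc t * h * r' + min (Suc s) (Suc t) * h * r'\<^sup>2\<close>. Bounding the minimum by the mean
  makes this at most \<open>1 + (s + t + 2) * u\<close>, and Bernoulli's inequality gives
  \<open>(1 + u) ^ (s + t + 2)\<close>; hence the exponent of the weight. The condition on
  \<open>b\<close> with factor \<open>1 - u\<close> suffices because
  \<open>(1 - u) * (1 + u) \<le> 1\<close>.\<close>

lemma pair_mean_weighted_le:
  assumes p: "0 \<le> p" "p \<le> h"
    and c: "\<And>s t. s \<le> N \<Longrightarrow> t \<le> N \<Longrightarrow> (\<Sum>k<s. \<Sum>l<t. p ^ card {k, l}) \<le> real (min s t) * h"
    and b: "\<And>j. j \<le> m \<Longrightarrow> 0 < b j"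
      "\<And>j. j < m \<Longrightarrow> b j \<le> b (Suc j) * (1 - (h / b (Suc j) + h / (2 * (b (Suc j))\<^sup>2)))"
    and "j \<le> m"
  shows "(\<Sum>s\<le>N. \<Sum>t\<le>N. pair_mean p j s t * (1 / b j) ^ (s + t + 2)) \<le> (1 / b 0)\<^sup>2"
  using \<open>j \<le> m\<close>
proof (induction j)
  case 0
  have "pair_mean p 0 s t * (1 / b 0) ^ (s + t + 2) = (if t = 0 then if s = 0 then (1 / b 0)\<^sup>2 else 0 else 0)" for s t
    by (auto simp: power2_eq_square)
  then show ?case by (simp only: sum.delta finite_atMost) simp
next
  case (Suc j)
  define r r' u where "r = 1 / b j" and "r' = 1 / b (Suc j)" and "u = h * r' + h * r'\<^sup>2 / 2"
  let ?P = "pair_mean p j"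
  have h: "0 \<le> h" using p by simp
  have bj: "0 < b j" "0 < b (Suc j)" "b j \<le> b (Suc j) * (1 - u)"
    using Suc.prems b(1)[of j] b(1)[of "Suc j"] b(2)[of j]
    by (auto simp: u_def r'_def power_divide mult.commute)
  have r: "0 < r" "0 < r'" and u: "0 \<le> u" "u < 1"
    using bj h zero_less_mult_pos[of "b (Suc j)" "1 - u"] by (auto simp: r_def r'_def u_def)
  have "b j * (1 + u) \<le> b (Suc j) * ((1 - u) * (1 + u))"
    using mult_right_mono[OF bj(3), of "1 + u"] u by (simp add: algebra_simps)
  also have "\<dots> \<le> b (Suc j) * 1"
    using bj by (intro mult_left_mono) (auto simp: algebra_simps)
  finally have rr': "r' * (1 + u) \<le> r"
    using bj by (simp add: r_def r'_def field_simps)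
  have P: "0 \<le> ?P s t" for s t by (rule pair_mean_nonneg[OF p(1)])
  have weight: "r' ^ (s + t + 2) * (1 + Suc s * h * r' + Suc t * h * r' + min (Suc s) (Suc t) * h * r'\<^sup>2)
      \<le> r ^ (s + t + 2)" for s t
  proof -
    have "real (min (Suc s) (Suc t)) \<le> real (s + t + 2) / 2" by auto
    then have "min (Suc s) (Suc t) * h * r'\<^sup>2 \<le> real (s + t + 2) / 2 * h * r'\<^sup>2"
      using h by (intro mult_right_mono) auto
    then have "1 + Suc s * h * r' + Suc t * h * r' + min (Suc s) (Suc t) * h * r'\<^sup>2 \<le> 1 + (s + t + 2) * u"
      by (simp add: u_def algebra_simps add_divide_distrib)
    also have "\<dots> \<le> (1 + u) ^ (s + t + 2)"
      using u by (intro Bernoulli_inequality) auto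
    finally have "r' ^ (s + t + 2) * (1 + Suc s * h * r' + Suc t * h * r' + min (Suc s) (Suc t) * h * r'\<^sup>2)
        \<le> (r' * (1 + u)) ^ (s + t + 2)"
      using r by (simp only: power_mult_distrib) (intro mult_left_mono, auto)
    also have "\<dots> \<le> r ^ (s + t + 2)"
      using rr' r u by (intro power_mono) auto
    finally show ?thesis .
  qed
  define f where "f s t = ?P s t * r' ^ (s + t + 2)" for s t
  define g1 where "g1 s t = real s * h * ?P (s - 1) t * r' ^ (s + t + 2)" for s t
  define g2 where "g2 s t = real t * h * ?P s (t - 1) * r' ^ (s + t + 2)" for s t
  define g3 where "g3 s t = real (min s t) * h * ?P (s - 1) (t - 1) * r' ^ (s + t + 2)" for s t
  have g: "0 \<le> g1 s t" "0 \<le> g2 s t" "0 \<le> g3 s t" for s t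
    using h r P by (auto simp: g1_def g2_def g3_def)
  have "(\<Sum>s\<le>N. \<Sum>t\<le>N. pair_mean p (Suc j) s t * r' ^ (s + t + 2))
      \<le> (\<Sum>s\<le>N. \<Sum>t\<le>N. f s t + g1 s t + g2 s t + g3 s t)"
  proof (intro sum_mono)
    fix s t assume st: "s \<in> {..N}" "t \<in> {..N}"
    have "pair_mean p (Suc j) s t \<le> ?P s t + real s * h * ?P (s - 1) t + real t * h * ?P s (t - 1)
        + real (min s t) * h * ?P (s - 1) (t - 1)"
      unfolding pair_mean.simps using p c st P by (intro add_mono mult_right_mono mult_left_mono) auto
    then have "pair_mean p (Suc j) s t * r' ^ (s + t + 2) \<le> (?P s t + real s * h * ?P (s - 1) t
        + real t * h * ?P s (t - 1) + real (min s t) * h * ?P (s - 1) (t - 1)) * r' ^ (s + t + 2)"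
      using r by (intro mult_right_mono) auto
    then show "pair_mean p (Suc j) s t * r' ^ (s + t + 2) \<le> f s t + g1 s t + g2 s t + g3 s t"
      by (simp only: f_def g1_def g2_def g3_def distrib_right)
  qed
  also have "\<dots> = (\<Sum>s\<le>N. \<Sum>t\<le>N. f s t) + (\<Sum>s\<le>N. \<Sum>t\<le>N. g1 s t) + (\<Sum>s\<le>N. \<Sum>t\<le>N. g2 s t) + (\<Sum>s\<le>N. \<Sum>t\<le>N. g3 s t)"
    by (simp only: sum.distrib)
  also have "\<dots> \<le> (\<Sum>s\<le>N. \<Sum>t\<le>N. f s t) + (\<Sum>s\<le>N. \<Sum>t\<le>N. g1 (Suc s) t)
      + (\<Sum>s\<le>N. \<Sum>t\<le>N. g2 s (Suc t)) + (\<Sum>s\<le>N. \<Sum>t\<le>N. g3 (Suc s) (Suc t))"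
  \<comment> \<open>The factors \<open>s\<close>, \<open>t\<close> and \<open>min s t\<close> kill
    the terms with index \<open>0\<close>, and the terms added at \<open>Suc N\<close> are
    nonnegative. After the shift all four summands involve the same \<open>?P s t\<close>.\<close>
  proof (intro add_mono order.refl)
    show "(\<Sum>s\<le>N. \<Sum>t\<le>N. g1 s t) \<le> (\<Sum>s\<le>N. \<Sum>t\<le>N. g1 (Suc s) t)"
      by (rule sum_le_sum_Suc) (auto simp: g1_def[of 0] intro!: sum_nonneg g)
    show "(\<Sum>s\<le>N. \<Sum>t\<le>N. g2 s t) \<le> (\<Sum>s\<le>N. \<Sum>t\<le>N. g2 s (Suc t))"
      by (intro sum_mono sum_le_sum_Suc g) (simp add: g2_def)
    have "(\<Sum>s\<le>N. \<Sum>t\<le>N. g3 s t) \<le> (\<Sum>s\<le>N. \<Sum>t\<le>N. g3 (Suc s) t)"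
      by (rule sum_le_sum_Suc) (auto simp: g3_def[of 0] intro!: sum_nonneg g)
    also have "\<dots> \<le> (\<Sum>s\<le>N. \<Sum>t\<le>N. g3 (Suc s) (Suc t))"
      by (intro sum_mono sum_le_sum_Suc g) (simp add: g3_def)
    finally show "(\<Sum>s\<le>N. \<Sum>t\<le>N. g3 s t) \<le> (\<Sum>s\<le>N. \<Sum>t\<le>N. g3 (Suc s) (Suc t))" .
  qed
  also have "\<dots> = (\<Sum>s\<le>N. \<Sum>t\<le>N. f s t + g1 (Suc s) t + g2 s (Suc t) + g3 (Suc s) (Suc t))"
    by (simp only: sum.distrib)
  also have "\<dots> \<le> (\<Sum>s\<le>N. \<Sum>t\<le>N. ?P s t * r ^ (s + t + 2))"
  proof (intro sum_mono)
    fix s t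
    have "f s t + g1 (Suc s) t + g2 s (Suc t) + g3 (Suc s) (Suc t)
        = ?P s t * (r' ^ (s + t + 2) * (1 + Suc s * h * r' + Suc t * h * r' + min (Suc s) (Suc t) * h * r'\<^sup>2))"
      by (simp add: f_def g1_def g2_def g3_def algebra_simps power2_eq_square)
    also have "\<dots> \<le> ?P s t * r ^ (s + t + 2)"
      using weight P by (intro mult_left_mono)
    finally show "f s t + g1 (Suc s) t + g2 s (Suc t) + g3 (Suc s) (Suc t) \<le> ?P s t * r ^ (s + t + 2)" .
  qed
  also have "\<dots> \<le> (1 / b 0)\<^sup>2"
    using Suc by (simp add: r_def)
  finally show ?case by (simp add: r'_def)
qed

text \<open>The weight is \<open>b j = sqrt (q (x j))\<close> with remaining time
  \<open>x j\<close>. It ends at \<open>b m = 1\<close>, where the weighted sum is the plain one,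
  and starts at \<open>(b 0)\<^sup>2 = \<delta>\<close>. For the step,
  \<open>q x \<le> (1 - x)\<^sup>2\<close> shows that \<open>q\<close> falls by at least
  \<open>2 * h * B + h - h\<^sup>2\<close> when the remaining time grows by \<open>h\<close>; the
  square of \<open>B - h - h / (2 * B)\<close> lies no lower.\<close>

lemma pair_mean_upper:
  assumes p: "0 \<le> p" "p \<le> h" and m: "0 < m" and \<beta>: "h * real m = \<beta>" "\<beta> < 1"
    and \<delta>: "\<delta> = (1 - \<beta>)\<^sup>2 - \<beta>" "0 < \<delta>" "2 * h \<le> \<delta>"
    and c: "\<And>s t. s \<le> N \<Longrightarrow> t \<le> N \<Longrightarrow> (\<Sum>k<s. \<Sum>l<t. p ^ card {k, l}) \<le> real (min s t) * h"
  shows "(\<Sum>s\<le>N. \<Sum>t\<le>N. pair_mean p m s t) \<le> 1 / \<delta>"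
proof -
  define q where "q x = (1 - x)\<^sup>2 - x" for x :: real
  define x where "x j = h * (real m - real j)" for j
  define b where "b j = sqrt (q (x j))" for j
  have h: "0 \<le> h" using p by simp
  have x: "0 \<le> x j" "x j \<le> \<beta>" if "j \<le> m" for j
    using h that by (auto simp: x_def \<beta>(1)[symmetric] intro!: mult_left_mono)
  have q: "\<delta> \<le> q (x j)" if "j \<le> m" for j
    using x[OF that] \<beta>(2) unfolding \<delta>(1) q_def by (intro diff_mono power_mono) auto
  have b: "0 < b j" "(b j)\<^sup>2 = q (x j)" if "j \<le> m" for j
    using q[OF that] \<delta> by (auto simp: b_def)
  have "0 \<le> \<beta>" using h by (auto simp: \<beta>(1)[symmetric])
  have "\<delta> \<le> 1\<^sup>2 - 0" unfolding \<delta>(1) using \<open>0 \<le> \<beta>\<close> \<beta>(2) by (intro diff_mono power_mono) auto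
  then have \<delta>1: "\<delta> \<le> 1" by simp
  have step: "b j \<le> b (Suc j) * (1 - (h / b (Suc j) + h / (2 * (b (Suc j))\<^sup>2)))" if j: "j < m" for j
  proof -
    define B u where "B = b (Suc j)" and "u = h / b (Suc j) + h / (2 * (b (Suc j))\<^sup>2)"
    have B: "0 < B" "B\<^sup>2 = q (x (Suc j))" "\<delta> \<le> B\<^sup>2"
      using b[of "Suc j"] q[of "Suc j"] j by (auto simp: B_def)
    have "\<delta>\<^sup>2 \<le> \<delta>" using \<delta> \<delta>1 by (simp add: power2_eq_square mult_left_le)
    then have \<delta>B: "\<delta> \<le> B"
      using B \<delta> by (intro power2_le_imp_le[of \<delta> B]) auto
    have "h / B \<le> h / \<delta>" "h / (2 * B\<^sup>2) \<le> h / (2 * \<delta>)"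
      using h B \<delta> \<delta>B by (auto intro!: divide_left_mono)
    moreover have "h / \<delta> \<le> 1 / 2" "h / (2 * \<delta>) \<le> 1 / 4"
      using \<delta>(2,3) by (simp_all add: field_simps)
    \<comment> \<open>Makes \<open>B * (1 - u)\<close> nonnegative, so that the comparison of
      squares below yields the comparison of \<open>b j\<close> with it.\<close>
    ultimately have u1: "u \<le> 1"
      unfolding u_def B_def[symmetric] by linarith
    have "B\<^sup>2 \<le> (1 - x (Suc j))\<^sup>2"
      using x[of "Suc j"] j unfolding B q_def by auto
    then have B1: "B \<le> 1 - x (Suc j)"
      using x[of "Suc j"] j \<beta>(2) by (intro power2_le_imp_le[of B]) auto
    have "x j = x (Suc j) + h" by (simp add: x_def algebra_simps)
    then have "(b j)\<^sup>2 = B\<^sup>2 - 2 * h * (1 - x (Suc j)) + h\<^sup>2 - h"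
      using b[of j] j unfolding B(2) by (simp add: q_def power2_eq_square algebra_simps)
    also have "\<dots> \<le> B\<^sup>2 - 2 * h * B + h\<^sup>2 - h"
      using B1 h by (simp add: mult_left_mono)
    also have "\<dots> \<le> (B * (1 - u))\<^sup>2"
    proof -
      have Bu: "B * (1 - u) = B - h - h / (2 * B)"
        using B(1) unfolding u_def B_def[symmetric] by (simp add: field_simps power2_eq_square)
      have "(B - (h + h / (2 * B)))\<^sup>2 = B\<^sup>2 - 2 * B * (h + h / (2 * B)) + (h + h / (2 * B))\<^sup>2"
        by (simp add: power2_eq_square algebra_simps)
      moreover have "2 * B * (h + h / (2 * B)) = 2 * h * B + h"
        using B(1) by (simp add: field_simps)
      moreover have "h\<^sup>2 \<le> (h + h / (2 * B))\<^sup>2"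
        using h B(1) by (intro power_mono) auto
      ultimately show ?thesis unfolding Bu by (simp add: diff_diff_eq)
    qed
    finally have "b j \<le> B * (1 - u)"
      using B(1) u1 by (intro power2_le_imp_le[of "b j"]) auto
    then show ?thesis by (simp add: B_def u_def)
  qed
  have "(\<Sum>s\<le>N. \<Sum>t\<le>N. pair_mean p m s t * (1 / b m) ^ (s + t + 2)) \<le> (1 / b 0)\<^sup>2"
    by (rule pair_mean_weighted_le[where b = b, OF p c b(1) step]) auto
  moreover have "b m = 1" by (simp add: b_def q_def x_def)
  moreover have "(b 0)\<^sup>2 = \<delta>" using b(2)[of 0] by (simp add: q_def x_def \<beta> \<delta>)
  ultimately show ?thesis by (simp add: power_divide)
qed

section \<open>Moments of the discrete counts\<close>

locale poisson_configuration = prob_space M for M :: "'w measure" +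
  fixes \<alpha> :: real and \<xi> :: "nat \<Rightarrow> 'w \<Rightarrow> real measure"
  assumes poisson: "\<And>k. poisson_point_process M \<alpha> (\<xi> k)"
    and indep: "indep_vars (\<lambda>_. point_process_algebra) \<xi> UNIV"
begin

definition cell_prob :: "nat \<Rightarrow> real" where
  "cell_prob m = 1 - exp (- (\<alpha> / m))"

lemma integer_valued: "\<omega> \<in> space M \<Longrightarrow> integer_valued_measure (\<xi> k \<omega>)"
  using poisson[of k] measurable_space[of "\<xi> k" M point_process_algebra \<omega>]
  by (simp add: poisson_point_process_def space_point_process_algebra)

lemma measurable_cell_count:
  assumes "0 < m"
  shows "(\<lambda>\<omega>. emeasure (\<xi> k \<omega>) (cell m j)) \<in> borel_measurable M"
proof -
  have "\<xi> k \<in> measurable M point_process_algebra"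
    using poisson[of k] by (simp add: poisson_point_process_def)
  then show ?thesis
    by (rule measurable_compose[OF _ measurable_count[OF cell_in_sets[OF assms]]])
qed

lemma pred_occupied:
  assumes "0 < m"
  shows "Measurable.pred M (\<lambda>\<omega>. occupied (\<lambda>k. \<xi> k \<omega>) m j k)"
  unfolding occupied_def using measurable_cell_count[OF assms, measurable] by measurable

lemma prob_cell_nonempty:
  assumes "j < m"
  shows "prob {\<omega> \<in> space M. emeasure (\<xi> k \<omega>) (cell m j) \<noteq> 0} = cell_prob m"
proof -
  have m: "0 < m" using assms by simp
  have "prob {\<omega> \<in> space M. emeasure (\<xi> k \<omega>) (cell m j) = of_nat 0}
      = (\<alpha> * measure lborel (cell m j)) ^ 0 / fact 0 * exp (- (\<alpha> * measure lborel (cell m j)))"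
    using poisson[of k] cell_in_sets[OF m, of j] unfolding poisson_point_process_def by blast
  then have "prob {\<omega> \<in> space M. emeasure (\<xi> k \<omega>) (cell m j) = 0} = exp (- (\<alpha> / m))"
    using assms by (simp add: measure_cell)
  moreover have "{\<omega> \<in> space M. emeasure (\<xi> k \<omega>) (cell m j) = 0} \<in> events"
    using measurable_cell_count[OF m, measurable] by measurable
  moreover have "{\<omega> \<in> space M. emeasure (\<xi> k \<omega>) (cell m j) \<noteq> 0}
      = space M - {\<omega> \<in> space M. emeasure (\<xi> k \<omega>) (cell m j) = 0}" by auto
  ultimately show ?thesis
    by (simp add: prob_compl cell_prob_def)
qed

lemma prob_layer_occupied:
  assumes J: "finite J" "J \<subseteq> {..<m}"
  shows "prob {\<omega> \<in> space M. \<forall>j\<in>J. occupied (\<lambda>k. \<xi> k \<omega>) m j k} = cell_prob m ^ card J"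
proof (cases "J = {}")
  case True
  then show ?thesis by (simp add: prob_space)
next
  case False
  then have m: "0 < m" using J by auto
  have "range (cell m) \<subseteq> sets unit_borel" "disjoint_family (cell m)"
    using cell_in_sets[OF m] by (auto simp only: disjoint_family_on_def) (auto simp: cell_def)
  then have "indep_vars (\<lambda>_. borel) (\<lambda>i \<omega>. emeasure (\<xi> k \<omega>) (cell m i)) UNIV"
    using poisson[of k] unfolding poisson_point_process_def by blast
  then have "prob (\<Inter>j\<in>J. (\<lambda>\<omega>. emeasure (\<xi> k \<omega>) (cell m j)) -` (- {0}) \<inter> space M)
      = (\<Prod>j\<in>J. prob ((\<lambda>\<omega>. emeasure (\<xi> k \<omega>) (cell m j)) -` (- {0}) \<inter> space M))"
    using False J by (intro indep_varsD[where M' = "\<lambda>_. borel" and I = UNIV]) auto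
  also have "\<dots> = (\<Prod>j\<in>J. cell_prob m)"
  proof (rule prod.cong)
    fix j assume "j \<in> J"
    then show "prob ((\<lambda>\<omega>. emeasure (\<xi> k \<omega>) (cell m j)) -` (- {0}) \<inter> space M) = cell_prob m"
      using J prob_cell_nonempty[of j m k] by (auto simp: vimage_def Int_def conj_commute)
  qed simp
  also have "(\<Inter>j\<in>J. (\<lambda>\<omega>. emeasure (\<xi> k \<omega>) (cell m j)) -` (- {0}) \<inter> space M)
      = {\<omega> \<in> space M. \<forall>j\<in>J. occupied (\<lambda>k. \<xi> k \<omega>) m j k}"
    using False by (auto simp: occupied_def)
  finally show ?thesis by simp
qed

text \<open>\<open>I\<close> is split by layers: independence of the processes gives a product over
  the layers, and independence over disjoint cells gives the power \<open>card (J k)\<close> within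
  layer \<open>k\<close>.\<close>

lemma prob_all_occupied:
  assumes I: "finite I" "I \<subseteq> {..<m} \<times> UNIV"
  shows "prob {\<omega> \<in> space M. \<forall>(j, k)\<in>I. occupied (\<lambda>k. \<xi> k \<omega>) m j k} = cell_prob m ^ card I"
proof (cases "I = {}")
  case True
  then show ?thesis by (simp add: prob_space)
next
  case False
  then have m: "0 < m" using I by auto
  define K J where "K = snd ` I" and "J k = {j. (j, k) \<in> I}" for k
  have "J k \<subseteq> fst ` I" for k
    by (force simp: J_def)
  then have J: "finite (J k)" "J k \<subseteq> {..<m}" for k
    using I by (auto simp: J_def intro: finite_subset)
  have K: "finite K" "K \<noteq> {}" using I False by (auto simp: K_def)
  define A where "A k = {\<mu> \<in> space point_process_algebra. \<forall>j\<in>J k. emeasure \<mu> (cell m j) \<noteq> 0}" for k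
  have A: "A k \<in> sets point_process_algebra" for k
    unfolding A_def using J(1) measurable_count[OF cell_in_sets[OF m], measurable] by measurable
  have vimage: "\<xi> k -` A k \<inter> space M = {\<omega> \<in> space M. \<forall>j\<in>J k. occupied (\<lambda>k. \<xi> k \<omega>) m j k}" for k
    using integer_valued by (auto simp: A_def occupied_def space_point_process_algebra)
  have "{\<omega> \<in> space M. \<forall>(j, k)\<in>I. occupied (\<lambda>k. \<xi> k \<omega>) m j k} = (\<Inter>k\<in>K. \<xi> k -` A k \<inter> space M)"
    using K unfolding vimage by (auto simp: K_def J_def) force
  also have "prob \<dots> = (\<Prod>k\<in>K. prob (\<xi> k -` A k \<inter> space M))"
    using K A by (intro indep_varsD[OF indep]) auto
  also have "\<dots> = (\<Prod>k\<in>K. cell_prob m ^ card (J k))"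
    unfolding vimage using J by (simp add: prob_layer_occupied)
  also have "\<dots> = cell_prob m ^ (\<Sum>k\<in>K. card (J k))"
    by (simp add: power_sum)
  also have "(\<Sum>k\<in>K. card (J k)) = card (Sigma K J)"
    using K J by simp
  also have "\<dots> = card (prod.swap ` Sigma K J)"
    by (simp add: card_image)
  also have "prod.swap ` Sigma K J = I"
    by (auto simp: K_def J_def image_iff split: prod.splits) force+
  finally show ?thesis .
qed

lemma discrete_count_Suc_ennreal:
  "(of_nat (discrete_count X (Suc j) s) :: ennreal)
    = of_nat (discrete_count X j s) + (\<Sum>k<s. of_bool (X j k)) * of_nat (discrete_count X j (s - 1))"
proof -
  have "{k. k < s \<and> X j k} = {..<s} \<inter> {k. X j k}" by auto
  then have "(\<Sum>k<s. of_bool (X j k) :: ennreal) = of_nat (card {k. k < s \<and> X j k})"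
    by (simp add: of_bool_def sum.If_cases)
  then show ?thesis by simp
qed

lemma measurable_discrete_count:
  assumes "0 < m"
  shows "(\<lambda>\<omega>. of_nat (discrete_count (occupied (\<lambda>k. \<xi> k \<omega>) m) j s) :: ennreal) \<in> borel_measurable M"
proof (induction j arbitrary: s)
  case (Suc j)
  note [measurable] = Suc pred_occupied[OF assms]
  show ?case
    unfolding discrete_count_Suc_ennreal of_bool_def by measurable
qed simp

text \<open>The factor \<open>of_bool\<close> makes the induction independent of any factorisation of expectations:
  the last column only contributes further members of \<open>I\<close>.\<close>

lemma nn_integral_discrete_count:
  assumes m: "0 < m" and \<alpha>: "0 \<le> \<alpha>"
    and "finite I" "I \<subseteq> {j..<m} \<times> UNIV" "j \<le> m"
  shows "(\<integral>\<^sup>+\<omega>. of_bool (\<forall>(i, k)\<in>I. occupied (\<lambda>k. \<xi> k \<omega>) m i k)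
      * (of_nat (discrete_count (occupied (\<lambda>k. \<xi> k \<omega>) m) j s)
        * of_nat (discrete_count (occupied (\<lambda>k. \<xi> k \<omega>) m) j t)) \<partial>M)
    = ennreal (cell_prob m ^ card I * pair_mean (cell_prob m) j s t)"
  using assms(3-)
proof (induction j arbitrary: I s t)
  case 0
  have [measurable]: "{\<omega> \<in> space M. \<forall>(i, k)\<in>I. occupied (\<lambda>k. \<xi> k \<omega>) m i k} \<in> events"
    using 0 pred_occupied[OF m, measurable] by measurable
  have "(\<integral>\<^sup>+\<omega>. of_bool (\<forall>(i, k)\<in>I. occupied (\<lambda>k. \<xi> k \<omega>) m i k) \<partial>M)
      = (\<integral>\<^sup>+\<omega>. indicator {\<omega> \<in> space M. \<forall>(i, k)\<in>I. occupied (\<lambda>k. \<xi> k \<omega>) m i k} \<omega> \<partial>M)"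
    by (intro nn_integral_cong) (simp add: indicator_def of_bool_def)
  also have "\<dots> = ennreal (cell_prob m ^ card I)"
    using 0 prob_all_occupied[of I m] by (simp add: emeasure_eq_measure atLeast0LessThan)
  finally show ?case by simp
next
  case (Suc j)
  define p where "p = cell_prob m"
  have p: "0 \<le> p" using \<alpha> by (simp add: p_def cell_prob_def)
  define Q :: "(nat \<times> nat) set \<Rightarrow> 'w \<Rightarrow> ennreal"
    where "Q I \<omega> = of_bool (\<forall>(i, k)\<in>I. occupied (\<lambda>k. \<xi> k \<omega>) m i k)" for I \<omega>
  define c :: "nat \<Rightarrow> nat \<Rightarrow> 'w \<Rightarrow> ennreal"
    where "c j s \<omega> = of_nat (discrete_count (occupied (\<lambda>k. \<xi> k \<omega>) m) j s)" for j s \<omega>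
  have Q_insert: "Q (insert (i, k) I) \<omega> = of_bool (occupied (\<lambda>k. \<xi> k \<omega>) m i k) * Q I \<omega>" for i k I \<omega>
    by (simp add: Q_def)
  have [measurable]: "c i s \<in> borel_measurable M" for i s
    unfolding c_def by (rule measurable_discrete_count[OF m])
  have Q_meas: "Q I \<in> borel_measurable M" if "finite I" for I
    unfolding Q_def of_bool_def using that pred_occupied[OF m, measurable] by measurable
  have [measurable]: "Q I \<in> borel_measurable M" "Q (insert a I) \<in> borel_measurable M"
      "Q (insert b (insert a I)) \<in> borel_measurable M" for a b
    using Suc.prems by (auto intro: Q_meas)
  have IH: "(\<integral>\<^sup>+\<omega>. Q I' \<omega> * (c j s \<omega> * c j t \<omega>) \<partial>M) = ennreal (p ^ card I' * pair_mean p j s t)"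
    if "finite I'" "I' \<subseteq> {j..<m} \<times> UNIV" for I' s t
    unfolding Q_def c_def p_def using Suc.prems that by (intro Suc.IH) auto
  \<comment> \<open>The members of \<open>I\<close> lie in columns after \<open>j\<close>, so
    inserting \<open>(j, k)\<close> and \<open>(j, l)\<close> raises the cardinality by exactly
    \<open>card {k, l}\<close>.\<close>
  have new: "(j, k) \<notin> I" for k using Suc.prems by auto
  have I: "finite I" "I \<subseteq> {j..<m} \<times> UNIV" "j < m" using Suc.prems by auto
  \<comment> \<open>The four parts record which of the two vertices use column \<open>j\<close>.
    Occupation indicators are absorbed into \<open>Q\<close>; for \<open>k = l\<close> the repeated
    insertion counts the event once, as it should.\<close>
  have expand: "Q I \<omega> * (c (Suc j) s \<omega> * c (Suc j) t \<omega>) = Q I \<omega> * (c j s \<omega> * c j t \<omega>)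
      + (\<Sum>k<s. Q (insert (j, k) I) \<omega> * (c j (s - 1) \<omega> * c j t \<omega>))
      + (\<Sum>l<t. Q (insert (j, l) I) \<omega> * (c j s \<omega> * c j (t - 1) \<omega>))
      + (\<Sum>k<s. \<Sum>l<t. Q (insert (j, k) (insert (j, l) I)) \<omega> * (c j (s - 1) \<omega> * c j (t - 1) \<omega>))" for \<omega>
  proof -
    let ?X = "\<lambda>s. \<Sum>k<s. of_bool (occupied (\<lambda>k. \<xi> k \<omega>) m j k) :: ennreal"
    have c: "c (Suc j) s \<omega> = c j s \<omega> + ?X s * c j (s - 1) \<omega>" for s
      unfolding c_def by (rule discrete_count_Suc_ennreal)
    have "?X s * ?X t = (\<Sum>k<s. \<Sum>l<t. of_bool (occupied (\<lambda>k. \<xi> k \<omega>) m j k) * of_bool (occupied (\<lambda>k. \<xi> k \<omega>) m j l))"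
      by (rule sum_product)
    moreover have "Q I \<omega> * (c (Suc j) s \<omega> * c (Suc j) t \<omega>) = Q I \<omega> * (c j s \<omega> * c j t \<omega>)
      + ?X s * (Q I \<omega> * (c j (s - 1) \<omega> * c j t \<omega>))
      + ?X t * (Q I \<omega> * (c j s \<omega> * c j (t - 1) \<omega>))
      + (?X s * ?X t) * (Q I \<omega> * (c j (s - 1) \<omega> * c j (t - 1) \<omega>))"
      unfolding c by (simp only: distrib_left distrib_right mult_ac add_ac)
    ultimately show ?thesis
      by (simp only: Q_insert sum_distrib_right mult.assoc)
  qed
  have "(\<integral>\<^sup>+\<omega>. Q I \<omega> * (c (Suc j) s \<omega> * c (Suc j) t \<omega>) \<partial>M) = (\<integral>\<^sup>+\<omega>. Q I \<omega> * (c j s \<omega> * c j t \<omega>) \<partial>M)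
      + (\<Sum>k<s. \<integral>\<^sup>+\<omega>. Q (insert (j, k) I) \<omega> * (c j (s - 1) \<omega> * c j t \<omega>) \<partial>M)
      + (\<Sum>l<t. \<integral>\<^sup>+\<omega>. Q (insert (j, l) I) \<omega> * (c j s \<omega> * c j (t - 1) \<omega>) \<partial>M)
      + (\<Sum>k<s. \<Sum>l<t. \<integral>\<^sup>+\<omega>. Q (insert (j, k) (insert (j, l) I)) \<omega> * (c j (s - 1) \<omega> * c j (t - 1) \<omega>) \<partial>M)"
    unfolding expand by (simp add: nn_integral_add nn_integral_sum)
  also have "\<dots> = ennreal (p ^ card I * pair_mean p j s t)
      + (\<Sum>k<s. ennreal (p ^ Suc (card I) * pair_mean p j (s - 1) t))
      + (\<Sum>l<t. ennreal (p ^ Suc (card I) * pair_mean p j s (t - 1)))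
      + (\<Sum>k<s. \<Sum>l<t. ennreal (p ^ (card I + card {k, l}) * pair_mean p j (s - 1) (t - 1)))"
  proof -
    have "(\<integral>\<^sup>+\<omega>. Q (insert (j, k) I) \<omega> * (c j s \<omega> * c j t \<omega>) \<partial>M) = ennreal (p ^ Suc (card I) * pair_mean p j s t)"
      for k s t
      using I new by (subst IH) auto
    moreover have "(\<integral>\<^sup>+\<omega>. Q (insert (j, k) (insert (j, l) I)) \<omega> * (c j s \<omega> * c j t \<omega>) \<partial>M)
        = ennreal (p ^ (card I + card {k, l}) * pair_mean p j s t)" for k l s t
      using I new by (subst IH) (auto simp: card_insert_if)
    moreover have "(\<integral>\<^sup>+\<omega>. Q I \<omega> * (c j s \<omega> * c j t \<omega>) \<partial>M) = ennreal (p ^ card I * pair_mean p j s t)"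
      using I by (intro IH)
    ultimately show ?thesis by (simp only:)
  qed
  also have "\<dots> = ennreal (p ^ card I * pair_mean p j s t
      + (\<Sum>k<s. p ^ Suc (card I) * pair_mean p j (s - 1) t)
      + (\<Sum>l<t. p ^ Suc (card I) * pair_mean p j s (t - 1))
      + (\<Sum>k<s. \<Sum>l<t. p ^ (card I + card {k, l}) * pair_mean p j (s - 1) (t - 1)))"
    using p by (simp add: ennreal_plus[symmetric] sum_nonneg pair_mean_nonneg sum_ennreal
        del: ennreal_plus sum_constant power_Suc)
  also have "\<dots> = ennreal (p ^ card I * pair_mean p (Suc j) s t)"
    by (simp add: power_add sum_distrib_left sum_distrib_right algebra_simps)
  finally show ?case
    by (simp only: Q_def c_def p_def)
qed

lemma nn_integral_discrete_count_mult:
  assumes m: "0 < m" and \<alpha>: "0 \<le> \<alpha>"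
  shows "(\<integral>\<^sup>+\<omega>. of_nat (discrete_count (occupied (\<lambda>k. \<xi> k \<omega>) m) m s)
      * of_nat (discrete_count (occupied (\<lambda>k. \<xi> k \<omega>) m) m t) \<partial>M)
    = ennreal (pair_mean (cell_prob m) m s t)"
  using nn_integral_discrete_count[OF m \<alpha>, of "{}" m s t] by simp

end

section \<open>Bounds for the size of the bump tree\<close>

lemma sum_discrete_count_le_bump_tree_size:
  assumes \<xi>: "\<And>k. integer_valued_measure (\<xi> k)" and m: "0 < m"
  shows "of_nat (\<Sum>s<n. discrete_count (occupied \<xi> m) m s) \<le> ennreal_of_enat (bump_tree_size \<xi>)"
proof (cases "finite (bump_tree \<xi>)")
  case True
  let ?R = "\<lambda>s. {v \<in> bump_tree \<xi>. length v = s \<and> (\<forall>x\<in>set v. col_index m x < m)}"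
  have "\<forall>s. \<exists>B\<subseteq>?R s. finite B \<and> card B = discrete_count (occupied \<xi> m) m s"
    by (intro allI discrete_count_le_card_bump_tree assms)
  then have "\<exists>B. \<forall>s. B s \<subseteq> ?R s \<and> finite (B s) \<and> card (B s) = discrete_count (occupied \<xi> m) m s"
    by (rule choice)
  then obtain B where *: "\<forall>s. B s \<subseteq> ?R s \<and> finite (B s) \<and> card (B s) = discrete_count (occupied \<xi> m) m s" ..
  have B: "B s \<subseteq> ?R s" "finite (B s)" "card (B s) = discrete_count (occupied \<xi> m) m s" for s
    using spec[OF *, of s] by simp_all
  have length_B: "length v = s" and tree_B: "v \<in> bump_tree \<xi>" if "v \<in> B s" for v s
    using subsetD[OF B(1) that] by simp_all
  have "B s \<inter> B t = {}" if "s \<noteq> t" for s t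
    using length_B[of _ s] length_B[of _ t] that by (metis disjoint_iff)
  then have "card (\<Union>s<n. B s) = (\<Sum>s<n. card (B s))"
    using B(2) by (intro card_UN_disjoint) simp_all
  then have "(\<Sum>s<n. discrete_count (occupied \<xi> m) m s) = card (\<Union>s<n. B s)"
    unfolding B(3) by (rule sym)
  also have "\<dots> \<le> card (bump_tree \<xi>)"
  proof (rule card_mono[OF True])
    show "(\<Union>s<n. B s) \<subseteq> bump_tree \<xi>" using tree_B by (intro UN_least subsetI)
  qed
  finally show ?thesis
    using True by (simp add: bump_tree_size_def del: of_nat_sum)
qed (simp add: bump_tree_size_def)

text \<open>The vertices in \<open>F\<close> involve finitely many points, which fine columns
  separate. Their entries are distinct, so \<open>N \<ge> card P\<close> admits all their
  lengths.\<close>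

lemma eventually_card_le_sum_discrete_count:
  assumes \<xi>: "\<And>k. integer_valued_measure (\<xi> k)"
    and m: "filterlim m at_top sequentially" and F: "finite F" "F \<subseteq> bump_tree \<xi>"
  shows "eventually (\<lambda>N. card F \<le> (\<Sum>s\<le>N. discrete_count (occupied \<xi> (m N)) (m N) s)) sequentially"
proof -
  have sets: "\<And>k. sets (\<xi> k) = sets unit_borel"
    using \<xi> by (simp add: integer_valued_measure_def)
  define P where "P = (\<Union>v\<in>F. set v)"
  have P: "finite P" "P \<subseteq> {0..1}"
    using F bump_tree_subset_unit[where \<xi> = \<xi>, OF sets] by (auto simp: P_def)
  have "eventually (\<lambda>N. inj_on (col_index (m N)) P) sequentially"
    by (rule eventually_compose_filterlim[OF eventually_inj_on_col_index[OF P] m])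
  moreover have "eventually (\<lambda>N. 0 < m N) sequentially"
    by (rule eventually_compose_filterlim[OF eventually_gt_at_top m])
  ultimately show ?thesis
    using eventually_ge_at_top[of "card P"]
  proof eventually_elim
    case (elim N)
    let ?R = "\<lambda>s. {v \<in> bump_tree \<xi>. length v = s \<and> set v \<subseteq> P \<and> (\<forall>x\<in>set v. col_index (m N) x < m N)}"
    have R: "finite (?R s)" "card (?R s) \<le> discrete_count (occupied \<xi> (m N)) (m N) s" for s
      using card_bump_tree_le_discrete_count[where \<xi> = \<xi>, OF \<xi> elim(2) P(1) elim(1)] by auto
    have "v \<in> (\<Union>s\<le>N. ?R s)" if v: "v \<in> F" for v
    proof -
      have "set v \<subseteq> P" using v by (auto simp: P_def)
      moreover have "distinct v"
        using v F bump_tree_distinct[where \<xi> = \<xi>, OF sets] by auto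
      ultimately have "length v \<le> N"
        using card_mono[OF P(1) \<open>set v \<subseteq> P\<close>] distinct_card[of v] elim(3) by linarith
      moreover have "col_index (m N) x < m N" if "x \<in> set v" for x
        using that \<open>set v \<subseteq> P\<close> P(2) by (intro col_index_less elim(2)) auto
      ultimately have "v \<in> ?R (length v)" "length v \<in> {..N}"
        using \<open>set v \<subseteq> P\<close> v F(2) by blast+
      then show ?thesis by blast
    qed
    then have "card F \<le> card (\<Union>s\<le>N. ?R s)"
      using R by (intro card_mono) auto
    also have "\<dots> \<le> (\<Sum>s\<le>N. card (?R s))"
      by (intro card_UN_le) simp
    also have "\<dots> \<le> (\<Sum>s\<le>N. discrete_count (occupied \<xi> (m N)) (m N) s)"
      using R by (intro sum_mono)
    finally show ?case .
  qed
qed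

text \<open>Prepares Fatou's lemma: the previous bound is applied to the whole tree if it is finite
  and to arbitrarily large finite parts otherwise.\<close>

lemma bump_tree_size_square_le_liminf:
  assumes \<xi>: "\<And>k. integer_valued_measure (\<xi> k)" and m: "filterlim m at_top sequentially"
  shows "(ennreal_of_enat (bump_tree_size \<xi>))\<^sup>2
    \<le> liminf (\<lambda>N. (of_nat (\<Sum>s\<le>N. discrete_count (occupied \<xi> (m N)) (m N) s))\<^sup>2)"
    (is "_ \<le> ?L")
proof -
  have *: "(of_nat (card F))\<^sup>2 \<le> ?L" if "finite F" "F \<subseteq> bump_tree \<xi>" for F
  proof (rule Liminf_bounded)
    show "\<forall>\<^sub>F N in sequentially. (of_nat (card F) :: ennreal)\<^sup>2
        \<le> (of_nat (\<Sum>s\<le>N. discrete_count (occupied \<xi> (m N)) (m N) s))\<^sup>2"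
      using eventually_card_le_sum_discrete_count[where \<xi> = \<xi>, OF \<xi> m that]
      by eventually_elim (intro power_mono, simp_all only: of_nat_le_iff zero_le)
  qed
  show ?thesis
  proof (cases "finite (bump_tree \<xi>)")
    case True
    then show ?thesis using *[of "bump_tree \<xi>"] by (simp add: bump_tree_size_def)
  next
    case False
    have "?L = top"
    proof (rule ccontr)
      assume "?L \<noteq> top"
      then obtain n where n: "?L < of_nat n"
        using ennreal_Ex_less_of_nat[of ?L] by (auto simp: less_top)
      obtain F where F: "finite F" "F \<subseteq> bump_tree \<xi>" "card F = n"
        using infinite_arbitrarily_large[OF False, of n] by blast
      have "(of_nat n :: ennreal) \<le> (of_nat n)\<^sup>2"
        by (simp only: of_nat_power[symmetric] of_nat_le_iff) (simp add: power2_eq_square)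
      then show False
        using *[OF F(1,2)] n F(3) by simp
    qed
    then show ?thesis by simp
  qed
qed

section \<open>The second moment of the tree size\<close>

context poisson_configuration
begin

text \<open>Of the square of the sum of counts only the products of equal lengths are kept.\<close>

lemma second_moment_ge:
  assumes m: "0 < m" and \<alpha>: "0 \<le> \<alpha>"
  shows "ennreal (\<Sum>s<n. pair_mean (cell_prob m) m s s)
    \<le> (\<integral>\<^sup>+\<omega>. (ennreal_of_enat (bump_tree_size (\<lambda>k. \<xi> k \<omega>)))\<^sup>2 \<partial>M)"
proof -
  define c :: "nat \<Rightarrow> 'w \<Rightarrow> ennreal"
    where "c s \<omega> = of_nat (discrete_count (occupied (\<lambda>k. \<xi> k \<omega>) m) m s)" for s \<omega>
  have [measurable]: "c s \<in> borel_measurable M" for s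
    unfolding c_def by (rule measurable_discrete_count[OF m])
  have "0 \<le> cell_prob m" using \<alpha> by (simp add: cell_prob_def)
  then have "ennreal (\<Sum>s<n. pair_mean (cell_prob m) m s s) = (\<Sum>s<n. \<integral>\<^sup>+\<omega>. c s \<omega> * c s \<omega> \<partial>M)"
    unfolding c_def nn_integral_discrete_count_mult[OF m \<alpha>]
    by (intro sum_ennreal[symmetric] pair_mean_nonneg)
  also have "\<dots> = (\<integral>\<^sup>+\<omega>. (\<Sum>s<n. c s \<omega> * c s \<omega>) \<partial>M)"
    by (simp add: nn_integral_sum)
  also have "\<dots> \<le> (\<integral>\<^sup>+\<omega>. (ennreal_of_enat (bump_tree_size (\<lambda>k. \<xi> k \<omega>)))\<^sup>2 \<partial>M)"
  proof (rule nn_integral_mono)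
    fix \<omega> assume \<omega>: "\<omega> \<in> space M"
    have "(\<Sum>s<n. c s \<omega> * c s \<omega>) \<le> (\<Sum>s<n. c s \<omega> * (\<Sum>t<n. c t \<omega>))"
      by (intro sum_mono mult_left_mono member_le_sum) auto
    also have "\<dots> = (\<Sum>s<n. c s \<omega>)\<^sup>2"
      by (simp add: power2_eq_square sum_distrib_right)
    also have "\<dots> \<le> (ennreal_of_enat (bump_tree_size (\<lambda>k. \<xi> k \<omega>)))\<^sup>2"
      using sum_discrete_count_le_bump_tree_size[where \<xi> = "\<lambda>k. \<xi> k \<omega>", OF integer_valued[OF \<omega>] m, of n]
      unfolding c_def by (intro power_mono) (simp_all only: of_nat_sum zero_le)
    finally show "(\<Sum>s<n. c s \<omega> * c s \<omega>) \<le> (ennreal_of_enat (bump_tree_size (\<lambda>k. \<xi> k \<omega>)))\<^sup>2" .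
  qed
  finally show ?thesis .
qed

lemma second_moment_infinite:
  assumes \<alpha>: "0 < \<alpha>" "\<alpha> \<le> 1" "1 \<le> \<alpha> + \<alpha>\<^sup>2"
  shows "(\<integral>\<^sup>+\<omega>. (ennreal_of_enat (bump_tree_size (\<lambda>k. \<xi> k \<omega>)))\<^sup>2 \<partial>M) = \<infinity>" (is "?E = _")
proof -
  have "of_nat n \<le> ?E" for n
  proof -
    \<comment> \<open>The delayed time of \<open>pair_mean_lower\<close>. For fixed \<open>s\<close>
      the delay becomes negligible as the columns become fine, so the time tends to
      \<alpha>.\<close>
    define x where "x s m = cell_prob m * real (m - 2 * s)" for s m
    have x: "x s \<longlonglongrightarrow> \<alpha>" for s
    proof -
      have "((\<lambda>m. (1 - exp (- (\<alpha> / real m))) * (real m - real (2 * s))) \<longlongrightarrow> \<alpha>) at_top"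
        using \<alpha> by real_asymp
      moreover have "eventually (\<lambda>m. (1 - exp (- (\<alpha> / real m))) * (real m - real (2 * s)) = x s m) sequentially"
        using eventually_ge_at_top[of "2 * s"]
        by eventually_elim (simp add: x_def cell_prob_def of_nat_diff)
      ultimately show ?thesis by (rule Lim_transform_eventually)
    qed
    have "eventually (\<lambda>m. ennreal (\<Sum>s<n. (x s m + (x s m)\<^sup>2) ^ s) \<le> ?E) sequentially"
      using eventually_gt_at_top[of 0]
    proof eventually_elim
      case (elim m)
      have p: "0 \<le> cell_prob m" using \<alpha> by (simp add: cell_prob_def)
      have "1 - \<alpha> / m \<le> exp (- (\<alpha> / m))"
        using exp_ge_add_one_self[of "- (\<alpha> / m)"] by simp
      then have "cell_prob m * real m \<le> \<alpha> / m * real m"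
        unfolding cell_prob_def by (intro mult_right_mono) auto
      then have "cell_prob m * real m \<le> 1"
        using elim \<alpha> by simp
      then have "(\<Sum>s<n. (x s m + (x s m)\<^sup>2) ^ s) \<le> (\<Sum>s<n. pair_mean (cell_prob m) m s s)"
        using pair_mean_lower[OF p] unfolding x_def Let_def by (intro sum_mono) blast
      then show ?case
        using second_moment_ge[OF elim, of n] \<alpha> by (meson ennreal_leI less_imp_le order_trans)
    qed
    moreover have "(\<lambda>m. ennreal (\<Sum>s<n. (x s m + (x s m)\<^sup>2) ^ s)) \<longlonglongrightarrow> ennreal (\<Sum>s<n. (\<alpha> + \<alpha>\<^sup>2) ^ s)"
      by (intro tendsto_ennrealI tendsto_sum tendsto_power tendsto_add x)
    ultimately have "ennreal (\<Sum>s<n. (\<alpha> + \<alpha>\<^sup>2) ^ s) \<le> ?E"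
      by (intro tendsto_upperbound[of _ _ sequentially]) auto
    moreover have "real n = (\<Sum>s<n. 1)" by simp
    then have "real n \<le> (\<Sum>s<n. (\<alpha> + \<alpha>\<^sup>2) ^ s)"
      using \<alpha> by (simp only:) (intro sum_mono one_le_power)
    ultimately show ?thesis
      by (metis ennreal_leI ennreal_of_nat_eq_real_of_nat order_trans)
  qed
  then have "?E = top"
    using ennreal_Ex_less_of_nat[of ?E] by (meson leD less_top)
  then show ?thesis by simp
qed

text \<open>Fatou's lemma with lengths truncated at \<open>N\<close>. The gap between \<alpha> and
  \<beta> absorbs the second-order terms in \<open>p\<close>, so that \<open>pair_mean_upper\<close>
  applies with \<open>h = \<beta> / m N\<close> and bounds every large \<open>N\<close> by
  \<open>1 / \<delta>\<close>.\<close>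

lemma second_moment_finite:
  assumes \<alpha>: "0 < \<alpha>" and \<beta>: "\<alpha> < \<beta>" "\<beta> < 1" and \<delta>: "0 < \<delta>" "\<delta> = (1 - \<beta>)\<^sup>2 - \<beta>"
  shows "(\<integral>\<^sup>+\<omega>. (ennreal_of_enat (bump_tree_size (\<lambda>k. \<xi> k \<omega>)))\<^sup>2 \<partial>M) < \<infinity>"
proof -
  \<comment> \<open>A quadratic number of columns makes \<open>N * p\<close> tend to
    \<open>0\<close>.\<close>
  define m :: "nat \<Rightarrow> nat" where "m N = (N + 1)\<^sup>2" for N
  define c :: "nat \<Rightarrow> nat \<Rightarrow> 'w \<Rightarrow> ennreal"
    where "c N s \<omega> = of_nat (discrete_count (occupied (\<lambda>k. \<xi> k \<omega>) (m N)) (m N) s)" for N s \<omega>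
  have m0: "0 < m N" for N by (simp add: m_def)
  have m: "filterlim m at_top sequentially"
    unfolding m_def by (rule filterlim_at_top_mono[OF filterlim_ident]) (auto simp: power2_eq_square)
  have c_meas[measurable]: "c N s \<in> borel_measurable M" for N s
    unfolding c_def by (rule measurable_discrete_count[OF m0])
  have "(\<integral>\<^sup>+\<omega>. (ennreal_of_enat (bump_tree_size (\<lambda>k. \<xi> k \<omega>)))\<^sup>2 \<partial>M)
      \<le> (\<integral>\<^sup>+\<omega>. liminf (\<lambda>N. (\<Sum>s\<le>N. c N s \<omega>)\<^sup>2) \<partial>M)"
    using bump_tree_size_square_le_liminf[where \<xi> = "\<lambda>k. \<xi> k \<omega>" for \<omega>, OF integer_valued m]
    unfolding c_def of_nat_sum by (rule nn_integral_mono)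
  also have "\<dots> \<le> liminf (\<lambda>N. \<integral>\<^sup>+\<omega>. (\<Sum>s\<le>N. c N s \<omega>)\<^sup>2 \<partial>M)"
    by (rule nn_integral_liminf) measurable
  also have "\<dots> \<le> limsup (\<lambda>N. \<integral>\<^sup>+\<omega>. (\<Sum>s\<le>N. c N s \<omega>)\<^sup>2 \<partial>M)"
    by (rule Liminf_le_Limsup) simp
  also have "\<dots> \<le> ennreal (1 / \<delta>)"
  proof (rule Limsup_bounded)
    have "eventually (\<lambda>N. \<alpha> * (1 + 1 / (real N + 1)) < \<beta>) sequentially"
    proof (rule order_tendstoD(2)[OF _ \<beta>(1)])
      show "(\<lambda>N. \<alpha> * (1 + 1 / (real N + 1))) \<longlonglongrightarrow> \<alpha>" by real_asymp
    qed
    moreover have "eventually (\<lambda>N. 2 * (\<beta> / real (m N)) < \<delta>) sequentially"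
    proof (rule order_tendstoD(2)[OF _ \<delta>(1)])
      show "(\<lambda>N. 2 * (\<beta> / real (m N))) \<longlonglongrightarrow> 0" unfolding m_def by real_asymp
    qed
    ultimately show "\<forall>\<^sub>F N in sequentially. (\<integral>\<^sup>+\<omega>. (\<Sum>s\<le>N. c N s \<omega>)\<^sup>2 \<partial>M) \<le> ennreal (1 / \<delta>)"
    proof eventually_elim
      case (elim N)
      define p h where "p = cell_prob (m N)" and "h = \<beta> / real (m N)"
      have p: "0 \<le> p" "p \<le> \<alpha> / m N"
        using \<alpha> exp_ge_add_one_self[of "- (\<alpha> / m N)"] by (simp_all add: p_def cell_prob_def)
      have "real N * (\<alpha> / m N) \<le> 1 / (real N + 1)"
      proof -
        have mN: "real (m N) = (real N + 1) * (real N + 1)"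
          by (simp add: m_def power2_eq_square algebra_simps)
        have "real N * \<alpha> \<le> real N * 1" using \<beta> by (intro mult_left_mono) auto
        then have "real N * \<alpha> / m N \<le> (real N + 1) / m N" by (intro divide_right_mono) auto
        also have "(real N + 1) / m N = 1 / (real N + 1)" unfolding mN by simp
        finally show ?thesis by simp
      qed
      then have "(\<alpha> / m N) * (1 + real N * (\<alpha> / m N)) \<le> (\<alpha> / m N) * (1 + 1 / (real N + 1))"
        using \<alpha> by (intro mult_left_mono add_mono) auto
      also have "\<dots> = \<alpha> * (1 + 1 / (real N + 1)) / m N" by simp
      also have "\<dots> \<le> h"
        unfolding h_def using elim by (intro divide_right_mono) auto
      finally have h: "(\<alpha> / m N) * (1 + real N * (\<alpha> / m N)) \<le> h" .
      have ph: "p * (1 + real N * p) \<le> h"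
        using p \<alpha> by (intro order.trans[OF _ h] mult_mono add_mono mult_left_mono) auto
      moreover have "p * 1 \<le> p * (1 + real N * p)"
        using p by (intro mult_left_mono) auto
      ultimately have "p \<le> h" by simp
      \<comment> \<open>Since \<open>s * t = min s t * max s t\<close> and
        \<open>max s t \<le> N\<close>, the second-order part is at most \<open>N * p\<close> times
        the diagonal part.\<close>
      have layers: "(\<Sum>k<s. \<Sum>l<t. p ^ card {k, l}) \<le> real (min s t) * h" if st: "s \<le> N" "t \<le> N" for s t
      proof -
        have "real s * real t = real (min s t) * real (max s t)" by (simp add: min_def max_def)
        also have "\<dots> \<le> real (min s t) * real N" using st by (intro mult_left_mono) auto
        finally have "real s * real t * p\<^sup>2 \<le> real (min s t) * real N * p\<^sup>2"
          by (intro mult_right_mono) auto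
        then have "(\<Sum>k<s. \<Sum>l<t. p ^ card {k, l}) \<le> real (min s t) * p + real (min s t) * real N * p\<^sup>2"
          using sum_power_card_pair_le[where s = s and t = t, OF p(1)] by linarith
        also have "\<dots> = real (min s t) * (p * (1 + real N * p))"
          by (simp add: algebra_simps power2_eq_square)
        also have "\<dots> \<le> real (min s t) * h" using ph by (intro mult_left_mono) auto
        finally show ?thesis .
      qed
      have "(\<integral>\<^sup>+\<omega>. (\<Sum>s\<le>N. c N s \<omega>)\<^sup>2 \<partial>M) = (\<Sum>s\<le>N. \<Sum>t\<le>N. \<integral>\<^sup>+\<omega>. c N s \<omega> * c N t \<omega> \<partial>M)"
        unfolding power2_eq_square sum_product by (simp add: nn_integral_sum)
      also have "\<dots> = (\<Sum>s\<le>N. \<Sum>t\<le>N. ennreal (pair_mean p (m N) s t))"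
        unfolding c_def p_def using nn_integral_discrete_count_mult[OF m0] \<alpha> by simp
      also have "\<dots> = ennreal (\<Sum>s\<le>N. \<Sum>t\<le>N. pair_mean p (m N) s t)"
        using p by (simp add: sum_nonneg pair_mean_nonneg)
      also have "\<dots> \<le> ennreal (1 / \<delta>)"
      proof (rule ennreal_leI, rule pair_mean_upper[OF p(1) \<open>p \<le> h\<close> m0 _ \<beta>(2) \<delta>(2,1)])
        show "h * real (m N) = \<beta>" using m0[of N] by (simp add: h_def)
        show "2 * h \<le> \<delta>" using elim by (simp add: h_def)
      qed (rule layers)
      finally show ?case .
    qed
  qed
  also have "\<dots> < \<infinity>" by simp
  finally show ?thesis .
qed

end

theorem theorem3:
  fixes M :: "'w measure" and \<alpha> :: real and \<xi> :: "nat \<Rightarrow> 'w \<Rightarrow> real measure"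
  assumes "prob_space M" and "0 < \<alpha>" and "\<alpha> \<le> 1"
    and "\<And>k. poisson_point_process M \<alpha> (\<xi> k)"
    and "prob_space.indep_vars M (\<lambda>_. point_process_algebra) \<xi> UNIV"
  shows "(\<alpha> \<ge> (sqrt 5 - 1) / 2 \<longrightarrow>
           (\<integral>\<^sup>+\<omega>. (ennreal_of_enat (bump_tree_size (\<lambda>k. \<xi> k \<omega>)))\<^sup>2 \<partial>M) = \<infinity>) \<and>
         (\<alpha> < (3 - sqrt 5) / 2 \<longrightarrow>
           (\<integral>\<^sup>+\<omega>. (ennreal_of_enat (bump_tree_size (\<lambda>k. \<xi> k \<omega>)))\<^sup>2 \<partial>M) < \<infinity>)"
proof -
  interpret poisson_configuration M \<alpha> \<xi>
    by (intro poisson_configuration.intro poisson_configuration_axioms.intro assms)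
  have sqrt5: "(sqrt 5)\<^sup>2 = 5" "2 < sqrt (5::real)"
    by (simp_all add: real_less_rsqrt)
  show ?thesis
  proof (intro conjI impI)
    assume "(sqrt 5 - 1) / 2 \<le> \<alpha>"
    \<comment> \<open>Completes the square: \<open>(2 * \<alpha> + 1)\<^sup>2 = 4 * (\<alpha> +
      \<alpha>\<^sup>2) + 1\<close>.\<close>
    then have "(sqrt 5)\<^sup>2 \<le> (2 * \<alpha> + 1)\<^sup>2"
      by (intro power_mono) auto
    then have "1 \<le> \<alpha> + \<alpha>\<^sup>2"
      unfolding sqrt5 by (simp add: power2_eq_square algebra_simps)
    then show "(\<integral>\<^sup>+\<omega>. (ennreal_of_enat (bump_tree_size (\<lambda>k. \<xi> k \<omega>)))\<^sup>2 \<partial>M) = \<infinity>"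
      using assms by (intro second_moment_infinite)
  next
    assume "\<alpha> < (3 - sqrt 5) / 2"
    then obtain \<beta> where \<beta>: "\<alpha> < \<beta>" "\<beta> < (3 - sqrt 5) / 2"
      using dense by blast
    \<comment> \<open>The threshold is the smaller root of
      \<open>(1 - \<beta>)\<^sup>2 = \<beta>\<close>, and \<open>(3 - 2 * \<beta>)\<^sup>2 = 4 * ((1
      - \<beta>)\<^sup>2 - \<beta>) + 5\<close>.\<close>
    then have "(sqrt 5)\<^sup>2 < (3 - 2 * \<beta>)\<^sup>2"
      by (intro power_strict_mono) auto
    then have "0 < (1 - \<beta>)\<^sup>2 - \<beta>"
      unfolding sqrt5 by (simp add: power2_eq_square algebra_simps)
    then show "(\<integral>\<^sup>+\<omega>. (ennreal_of_enat (bump_tree_size (\<lambda>k. \<xi> k \<omega>)))\<^sup>2 \<partial>M) < \<infinity>"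
      using assms(2) \<beta> sqrt5 by (intro second_moment_finite[of \<beta>]) auto
  qed
qed

end
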